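(* Let $\mathsf{C}$ be a category of groups with operations, let $G$ be an internal groupoid in $\mathsf{C}$ and let $\alpha\colon A\to B$ be the crossed module in $\mathsf{C}$ corresponding to $G$. Then the category $\mathsf{Cov}_{\mathsf{Cat}(\mathsf{C})}/G$ of covers of $G$ in the category $\mathsf{Cat}(\mathsf{C})$ of internal groupoids in $\mathsf{C}$ and the category $\mathsf{Cov}_{\mathsf{XMod}}/(\alpha\colon A\to B)$ of covers of the crossed module $\alpha\colon A\to B$ in $\mathsf{C}$ are equivalent.
   Context: Groupoids. A groupoid $G$ has a set of morphisms (called elements), also denoted $G$, a set of objects $G_0$, initial and final point maps $d_0,d_1\colon G\to G_0$, and an object inclusion $\epsilon\colon G_0\to G$. The composite $a\circ b$ is defined when $d_1(a)=d_0(b)$, and then $d_0(a\circ b)=d_0(a)$, $d_1(a\circ b)=d_1(b)$. $St_G x=\{a\in G: d_0(a)=x\}$ is the star of $x$. A morphism $p\colon\widetilde G\to G$ of groupoids is a covering morphism if for each $\tilde x\in\widetilde G_0$ the restriction $St_{\widetilde G}\tilde x\to St_G p(\tilde x)$ is bijective. Groups with operations. A category of groups with operations $\mathsf{C}$ is the category of groups equipped with a set of operations $\Omega$ satisfying a set of identities $\mathsf{E}$, where $\mathsf{E}$ includes the group laws and, with $\Omega_i$ the set of $i$-ary operations: (a) $\Omega=\Omega_0\cup\Omega_1\cup\Omega_2$; (b) the group operations, written additively (but not assumed commutative) $0,-,+$, are elements of $\Omega_0,\Omega_1,\Omega_2$ respectively; put $\Omega_2'=\Omega_2\setminus\{+\}$,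 $\Omega_1'=\Omega_1\setminus\{-\}$; if $\star\in\Omega_2'$ then $\star^\circ$, defined by $a\star^\circ b=b\star a$, is also in $\Omega_2'$; and $\Omega_0=\{0\}$; (c) for each $\star\in\Omega_2'$, $\mathsf{E}$ includes $a\star(b+c)=a\star b+a\star c$; (d) for each $\omega\in\Omega_1'$ and $\star\in\Omega_2'$, $\mathsf{E}$ includes $\omega(a+b)=\omega(a)+\omega(b)$ and $\omega(a)\star b=\omega(a\star b)$. Morphisms are group homomorphisms preserving the operations in $\Omega_1'$ and $\Omega_2'$. Internal groupoids. An internal groupoid (equivalently, internal category) $G$ in $\mathsf{C}$ is a category (automatically a groupoid) in which $G$ and $G_0$ are objects of $\mathsf{C}$ and $d_0,d_1\colon G\to G_0$, $\epsilon\colon G_0\to G$ and the partial composition $\circ\colon G_{d_1}\times_{d_0}G\to G$ are morphisms in $\mathsf{C}$. A morphism in $\mathsf{Cat}(\mathsf{C})$ is a morphism of the underlying groupoids which is also a morphism in $\mathsf{C}$. A morphism of internal groupoids is a cover (covering morphism) if it is a covering morphism on the underlying groupoids. $\mathsf{Cov}_{\mathsf{Cat}(\mathsf{C})}/G$ has as objects the covering morphisms $p\colon\widetilde G\to G$ of internal groupoids, and as morphisms from $p\colon\widetilde G\to G$ to $q\colon\widetilde H\to G$ the morphisms $f\colon\widetilde G\to\widetilde H$ of internal groupoids which are also covering morphisms and satisfy $qf=p$. Derived actions. Given a split extension $0\to A\to E\xrightarrow{p}B\to 0$ in $\mathsf{C}$ (that is, $p$ is surjective with kernel $A\to E$) with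 a splitting morphism $s\colon B\to E$, $ps=1_B$, the derived actions of $B$ on $A$ are $b\cdot a=s(b)+a-s(b)$ and $b\star a=s(b)\star a$ for $a\in A$, $b\in B$, $\star\in\Omega_2'$ (and $a\star b$ denotes $b\star^\circ a$). Crossed modules. A crossed module in $\mathsf{C}$ is a morphism $\alpha\colon A\to B$ in $\mathsf{C}$ together with a derived action of $B$ on $A$ such that for all $b\in B$, $a,a'\in A$, $\star\in\Omega_2'$: (CM1) $\alpha(b\cdot a)=b+\alpha(a)-b$; (CM2) $\alpha(a)\cdot a'=a+a'-a$; (CM3) $\alpha(a)\star a'=a\star a'$; (CM4) $\alpha(b\star a)=b\star\alpha(a)$ and $\alpha(a\star b)=\alpha(a)\star b$. A morphism from $\alpha\colon A\to B$ to $\alpha'\colon A'\to B'$ is a pair of morphisms $f_1\colon A\to A'$, $f_2\colon B\to B'$ in $\mathsf{C}$ with $f_2\alpha(a)=\alpha' f_1(a)$, $f_1(b\cdot a)=f_2(b)\cdot f_1(a)$ and $f_1(b\star a)=f_2(b)\star f_1(a)$ for all $b\in B$, $a\in A$, $\star\in\Omega_2'$. This gives the category $\mathsf{XMod}$. The crossed module corresponding to an internal groupoid $G$ is $\alpha=d_1|\colon A=St_G 0=\operatorname{Ker} d_0\to B=G_0$, with $b\cdot a=\epsilon(b)+a-\epsilon(b)$ and $b\star a=\epsilon(b)\star a$. A morphism $(f_1,f_2)$ of crossed modules is a cover if $f_1$ is an isomorphism in $\mathsf{C}$. $\mathsf{Cov}_{\mathsf{XMod}}/(\alpha\colon A\to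 B)$ has as objects the covers $(f_1,f_2)$ with codomain $\alpha\colon A\to B$, and as morphisms the morphisms of crossed modules between their domains that are compatible with the covers to $\alpha\colon A\to B$ (commuting triangles). *)

theory Defs
  imports "HOL-Algebra.Coset"
begin

section \<open>Categories and equivalence of categories\<close>

text \<open>
  Hom-sets of different pairs of objects may overlap, so identities, composition and the action
  of a functor on morphisms take the objects involved as arguments: \<open>Comp C X Y Z g f\<close> is the
  composite of \<open>f : X \<rightarrow> Y\<close> followed by \<open>g : Y \<rightarrow> Z\<close>.
\<close>

record ('o, 'm) category =
  Obj :: "'o set"
  Hom :: "'o \<Rightarrow> 'o \<Rightarrow> 'm set"
  Ident :: "'o \<Rightarrow> 'm"
  Comp :: "'o \<Rightarrow> 'o \<Rightarrow> 'o \<Rightarrow> 'm \<Rightarrow> 'm \<Rightarrow> 'm"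

definition is_category :: "('o, 'm) category \<Rightarrow> bool" where
  "is_category C \<longleftrightarrow>
     (\<forall>X \<in> Obj C. Ident C X \<in> Hom C X X) \<and>
     (\<forall>X \<in> Obj C. \<forall>Y \<in> Obj C. \<forall>Z \<in> Obj C. \<forall>f \<in> Hom C X Y. \<forall>g \<in> Hom C Y Z.
        Comp C X Y Z g f \<in> Hom C X Z) \<and>
     (\<forall>X \<in> Obj C. \<forall>Y \<in> Obj C. \<forall>f \<in> Hom C X Y.
        Comp C X X Y f (Ident C X) = f \<and> Comp C X Y Y (Ident C Y) f = f) \<and>
     (\<forall>W \<in> Obj C. \<forall>X \<in> Obj C. \<forall>Y \<in> Obj C. \<forall>Z \<in> Obj C.
        \<forall>f \<in> Hom C W X. \<forall>g \<in> Hom C X Y. \<forall>h \<in> Hom C Y Z.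
        Comp C W X Z (Comp C X Y Z h g) f = Comp C W Y Z h (Comp C W X Y g f))"

definition is_functor ::
  "('o, 'm) category \<Rightarrow> ('p, 'n) category \<Rightarrow> ('o \<Rightarrow> 'p) \<Rightarrow> ('o \<Rightarrow> 'o \<Rightarrow> 'm \<Rightarrow> 'n) \<Rightarrow> bool" where
  "is_functor C D Fo Fm \<longleftrightarrow>
     (\<forall>X \<in> Obj C. Fo X \<in> Obj D) \<and>
     (\<forall>X \<in> Obj C. \<forall>Y \<in> Obj C. \<forall>f \<in> Hom C X Y. Fm X Y f \<in> Hom D (Fo X) (Fo Y)) \<and>
     (\<forall>X \<in> Obj C. Fm X X (Ident C X) = Ident D (Fo X)) \<and>
     (\<forall>X \<in> Obj C. \<forall>Y \<in> Obj C. \<forall>Z \<in> Obj C. \<forall>f \<in> Hom C X Y. \<forall>g \<in> Hom C Y Z.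
        Fm X Z (Comp C X Y Z g f) = Comp D (Fo X) (Fo Y) (Fo Z) (Fm Y Z g) (Fm X Y f))"

definition is_isomorphism :: "('o, 'm) category \<Rightarrow> 'o \<Rightarrow> 'o \<Rightarrow> 'm \<Rightarrow> bool" where
  "is_isomorphism C X Y f \<longleftrightarrow>
     f \<in> Hom C X Y \<and>
     (\<exists>g \<in> Hom C Y X. Comp C X Y X g f = Ident C X \<and> Comp C Y X Y f g = Ident C Y)"

definition is_natural_isomorphism ::
  "('o, 'm) category \<Rightarrow> ('p, 'n) category \<Rightarrow>
   ('o \<Rightarrow> 'p) \<Rightarrow> ('o \<Rightarrow> 'o \<Rightarrow> 'm \<Rightarrow> 'n) \<Rightarrow> ('o \<Rightarrow> 'p) \<Rightarrow> ('o \<Rightarrow> 'o \<Rightarrow> 'm \<Rightarrow> 'n) \<Rightarrow> ('o \<Rightarrow> 'n) \<Rightarrow> bool" where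
  "is_natural_isomorphism C D Fo Fm Go Gm \<eta> \<longleftrightarrow>
     (\<forall>X \<in> Obj C. is_isomorphism D (Fo X) (Go X) (\<eta> X)) \<and>
     (\<forall>X \<in> Obj C. \<forall>Y \<in> Obj C. \<forall>f \<in> Hom C X Y.
        Comp D (Fo X) (Go X) (Go Y) (Gm X Y f) (\<eta> X) = Comp D (Fo X) (Fo Y) (Go Y) (\<eta> Y) (Fm X Y f))"

definition equivalent_categories :: "('o, 'm) category \<Rightarrow> ('p, 'n) category \<Rightarrow> bool" where
  "equivalent_categories C D \<longleftrightarrow>
     is_category C \<and> is_category D \<and>
     (\<exists>Fo Fm Go Gm \<eta> \<theta>.
        is_functor C D Fo Fm \<and> is_functor D C Go Gm \<and>
        is_natural_isomorphism C C (\<lambda>X. X) (\<lambda>X Y f. f)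
          (\<lambda>X. Go (Fo X)) (\<lambda>X Y f. Gm (Fo X) (Fo Y) (Fm X Y f)) \<eta> \<and>
        is_natural_isomorphism D D (\<lambda>X. Fo (Go X)) (\<lambda>X Y f. Fm (Go X) (Go Y) (Gm X Y f))
          (\<lambda>X. X) (\<lambda>X Y f. f) \<theta>)"


section \<open>Categories of groups with operations\<close>

text \<open>
  Terms over the operations \<open>0\<close>, \<open>-\<close>, \<open>+\<close> and the operation symbols in \<open>\<Omega>\<^sub>1'\<close> (type \<open>'w\<close>) and
  \<open>\<Omega>\<^sub>2'\<close> (type \<open>'s\<close>).
\<close>

datatype ('w, 's) opterm =
    V nat
  | Zero
  | Neg "('w, 's) opterm"
  | Plus "('w, 's) opterm" "('w, 's) opterm"
  | UnOp 'w "('w, 's) opterm"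
  | BinOp 's "('w, 's) opterm" "('w, 's) opterm"

text \<open>
  \<open>opp\<close> sends the symbol of \<open>\<star>\<close> to the symbol of \<open>\<star>\<^sup>\<circ>\<close>. The sets \<open>\<Omega>\<^sub>1'\<close> and \<open>\<Omega>\<^sub>2'\<close> are sets
  rather than types because either may be empty.
\<close>

record ('w, 's) op_theory =
  Unary :: "'w set"
  Binary :: "'s set"
  opp :: "'s \<Rightarrow> 's"
  Identities :: "(('w, 's) opterm \<times> ('w, 's) opterm) set"

primrec wf_term :: "('w, 's) op_theory \<Rightarrow> ('w, 's) opterm \<Rightarrow> bool" where
  "wf_term T (V n) = True"
| "wf_term T Zero = True"
| "wf_term T (Neg t) = wf_term T t"
| "wf_term T (Plus t u) = (wf_term T t \<and> wf_term T u)"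
| "wf_term T (UnOp \<omega> t) = (\<omega> \<in> Unary T \<and> wf_term T t)"
| "wf_term T (BinOp \<beta> t u) = (\<beta> \<in> Binary T \<and> wf_term T t \<and> wf_term T u)"

definition group_identities :: "(('w, 's) opterm \<times> ('w, 's) opterm) set" where
  "group_identities =
     {(Plus (Plus (V 0) (V 1)) (V 2), Plus (V 0) (Plus (V 1) (V 2))),
      (Plus Zero (V 0), V 0), (Plus (V 0) Zero, V 0),
      (Plus (Neg (V 0)) (V 0), Zero), (Plus (V 0) (Neg (V 0)), Zero)}"

text \<open>
  Additivity of \<open>\<omega>\<close> is imposed for every \<open>\<omega> \<in> \<Omega>\<^sub>1'\<close>, also when \<open>\<Omega>\<^sub>2'\<close> is empty.
\<close>

definition groups_with_operations_theory :: "('w, 's) op_theory \<Rightarrow> bool" where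
  "groups_with_operations_theory T \<longleftrightarrow>
     (\<forall>(l, r) \<in> Identities T. wf_term T l \<and> wf_term T r) \<and>
     group_identities \<subseteq> Identities T \<and>
     (\<forall>\<beta> \<in> Binary T. opp T \<beta> \<in> Binary T \<and>
        (BinOp (opp T \<beta>) (V 0) (V 1), BinOp \<beta> (V 1) (V 0)) \<in> Identities T) \<and>
     (\<forall>\<beta> \<in> Binary T.
        (BinOp \<beta> (V 0) (Plus (V 1) (V 2)), Plus (BinOp \<beta> (V 0) (V 1)) (BinOp \<beta> (V 0) (V 2)))
          \<in> Identities T) \<and>
     (\<forall>\<omega> \<in> Unary T.
        (UnOp \<omega> (Plus (V 0) (V 1)), Plus (UnOp \<omega> (V 0)) (UnOp \<omega> (V 1))) \<in> Identities T) \<and>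
     (\<forall>\<omega> \<in> Unary T. \<forall>\<beta> \<in> Binary T.
        (BinOp \<beta> (UnOp \<omega> (V 0)) (V 1), UnOp \<omega> (BinOp \<beta> (V 0) (V 1))) \<in> Identities T)"

text \<open>
  The underlying group is a group of HOL-Algebra, whose notation is multiplicative:
  \<open>x \<otimes> y\<close>, \<open>\<one>\<close>, \<open>inv x\<close> stand for \<open>x + y\<close>, \<open>0\<close>, \<open>- x\<close>. No commutativity is assumed.
\<close>

record ('a, 'w, 's) gwo = "'a monoid" +
  unop :: "'w \<Rightarrow> 'a \<Rightarrow> 'a"
  binop :: "'s \<Rightarrow> 'a \<Rightarrow> 'a \<Rightarrow> 'a"

primrec eval_term :: "('a, 'w, 's) gwo \<Rightarrow> (nat \<Rightarrow> 'a) \<Rightarrow> ('w, 's) opterm \<Rightarrow> 'a" where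
  "eval_term X v (V n) = v n"
| "eval_term X v Zero = \<one>\<^bsub>X\<^esub>"
| "eval_term X v (Neg t) = inv\<^bsub>X\<^esub> (eval_term X v t)"
| "eval_term X v (Plus t u) = eval_term X v t \<otimes>\<^bsub>X\<^esub> eval_term X v u"
| "eval_term X v (UnOp \<omega> t) = unop X \<omega> (eval_term X v t)"
| "eval_term X v (BinOp \<beta> t u) = binop X \<beta> (eval_term X v t) (eval_term X v u)"

text \<open>
  The objects of \<open>C\<close>. All objects of a category considered below have carriers contained in one
  fixed type, which plays the role of the universe of sets. Values of operations outside the
  carrier are unspecified; they do not affect the isomorphism class of an object.
\<close>

definition is_gwo :: "('w, 's) op_theory \<Rightarrow> ('a, 'w, 's) gwo \<Rightarrow> bool" where
  "is_gwo T X \<longleftrightarrow>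
     group X \<and>
     (\<forall>\<omega> \<in> Unary T. unop X \<omega> \<in> carrier X \<rightarrow> carrier X) \<and>
     (\<forall>\<beta> \<in> Binary T. binop X \<beta> \<in> carrier X \<rightarrow> carrier X \<rightarrow> carrier X) \<and>
     (\<forall>(l, r) \<in> Identities T. \<forall>v \<in> UNIV \<rightarrow> carrier X. eval_term X v l = eval_term X v r)"

definition gwo_hom ::
  "('w, 's) op_theory \<Rightarrow> ('a, 'w, 's) gwo \<Rightarrow> ('b, 'w, 's) gwo \<Rightarrow> ('a \<Rightarrow> 'b) set" where
  "gwo_hom T X Y =
     {f \<in> hom X Y.
        (\<forall>\<omega> \<in> Unary T. \<forall>x \<in> carrier X. f (unop X \<omega> x) = unop Y \<omega> (f x)) \<and>
        (\<forall>\<beta> \<in> Binary T. \<forall>x \<in> carrier X. \<forall>y \<in> carrier X.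
           f (binop X \<beta> x y) = binop Y \<beta> (f x) (f y))}"

definition gwo_iso ::
  "('w, 's) op_theory \<Rightarrow> ('a, 'w, 's) gwo \<Rightarrow> ('b, 'w, 's) gwo \<Rightarrow> ('a \<Rightarrow> 'b) set" where
  "gwo_iso T X Y =
     {f \<in> gwo_hom T X Y. \<exists>g \<in> gwo_hom T Y X.
        (\<forall>x \<in> carrier X. g (f x) = x) \<and> (\<forall>y \<in> carrier Y. f (g y) = y)}"

definition gwo_pullback ::
  "('a, 'w, 's) gwo \<Rightarrow> ('b, 'w, 's) gwo \<Rightarrow> ('a \<Rightarrow> 'c) \<Rightarrow> ('b \<Rightarrow> 'c) \<Rightarrow> ('a \<times> 'b, 'w, 's) gwo" where
  "gwo_pullback X Y f g =
     \<lparr>carrier = {(x, y). x \<in> carrier X \<and> y \<in> carrier Y \<and> f x = g y},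
      monoid.mult = (\<lambda>(x, y) (x', y'). (x \<otimes>\<^bsub>X\<^esub> x', y \<otimes>\<^bsub>Y\<^esub> y')),
      one = (\<one>\<^bsub>X\<^esub>, \<one>\<^bsub>Y\<^esub>),
      unop = (\<lambda>\<omega> (x, y). (unop X \<omega> x, unop Y \<omega> y)),
      binop = (\<lambda>\<beta> (x, y) (x', y'). (binop X \<beta> x x', binop Y \<beta> y y'))\<rparr>"

definition gwo_kernel ::
  "('a, 'w, 's) gwo \<Rightarrow> ('b, 'w, 's) gwo \<Rightarrow> ('a \<Rightarrow> 'b) \<Rightarrow> ('a, 'w, 's) gwo" where
  "gwo_kernel X Y f = X\<lparr>carrier := kernel X Y f\<rparr>"


section \<open>Groupoids and covering morphisms\<close>

text \<open>
  The composite \<open>cmp A a b\<close> of \<open>a\<close> and \<open>b\<close> is meaningful when \<open>fin A a = ini A b\<close>.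
\<close>

record ('m, 'o) groupoid =
  Mor :: "'m set"
  Ob :: "'o set"
  ini :: "'m \<Rightarrow> 'o"
  fin :: "'m \<Rightarrow> 'o"
  unit :: "'o \<Rightarrow> 'm"
  cmp :: "'m \<Rightarrow> 'm \<Rightarrow> 'm"

definition is_groupoid :: "('m, 'o) groupoid \<Rightarrow> bool" where
  "is_groupoid A \<longleftrightarrow>
     ini A \<in> Mor A \<rightarrow> Ob A \<and> fin A \<in> Mor A \<rightarrow> Ob A \<and> unit A \<in> Ob A \<rightarrow> Mor A \<and>
     (\<forall>x \<in> Ob A. ini A (unit A x) = x \<and> fin A (unit A x) = x) \<and>
     (\<forall>a \<in> Mor A. \<forall>b \<in> Mor A. fin A a = ini A b \<longrightarrow>
        cmp A a b \<in> Mor A \<and> ini A (cmp A a b) = ini A a \<and> fin A (cmp A a b) = fin A b) \<and>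
     (\<forall>a \<in> Mor A. cmp A (unit A (ini A a)) a = a \<and> cmp A a (unit A (fin A a)) = a) \<and>
     (\<forall>a \<in> Mor A. \<forall>b \<in> Mor A. \<forall>c \<in> Mor A. fin A a = ini A b \<longrightarrow> fin A b = ini A c \<longrightarrow>
        cmp A (cmp A a b) c = cmp A a (cmp A b c)) \<and>
     (\<forall>a \<in> Mor A. \<exists>b \<in> Mor A. ini A b = fin A a \<and> fin A b = ini A a \<and>
        cmp A a b = unit A (ini A a) \<and> cmp A b a = unit A (fin A a))"

definition groupoid_morphism ::
  "('m, 'o) groupoid \<Rightarrow> ('n, 'p) groupoid \<Rightarrow> ('m \<Rightarrow> 'n) \<times> ('o \<Rightarrow> 'p) \<Rightarrow> bool" where
  "groupoid_morphism A B f \<longleftrightarrow>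
     fst f \<in> Mor A \<rightarrow> Mor B \<and> snd f \<in> Ob A \<rightarrow> Ob B \<and>
     (\<forall>a \<in> Mor A. ini B (fst f a) = snd f (ini A a) \<and> fin B (fst f a) = snd f (fin A a)) \<and>
     (\<forall>x \<in> Ob A. fst f (unit A x) = unit B (snd f x)) \<and>
     (\<forall>a \<in> Mor A. \<forall>b \<in> Mor A. fin A a = ini A b \<longrightarrow>
        fst f (cmp A a b) = cmp B (fst f a) (fst f b))"

definition St :: "('m, 'o) groupoid \<Rightarrow> 'o \<Rightarrow> 'm set" where
  "St A x = {a \<in> Mor A. ini A a = x}"

definition covering_morphism ::
  "('m, 'o) groupoid \<Rightarrow> ('n, 'p) groupoid \<Rightarrow> ('m \<Rightarrow> 'n) \<times> ('o \<Rightarrow> 'p) \<Rightarrow> bool" where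
  "covering_morphism A B p \<longleftrightarrow>
     groupoid_morphism A B p \<and>
     (\<forall>x \<in> Ob A. bij_betw (fst p) (St A x) (St B (snd p x)))"


section \<open>Internal groupoids and their covers\<close>

record ('u, 'w, 's) igpd =
  elts :: "('u, 'w, 's) gwo"
  objs :: "('u, 'w, 's) gwo"
  d0 :: "'u \<Rightarrow> 'u"
  d1 :: "'u \<Rightarrow> 'u"
  eps :: "'u \<Rightarrow> 'u"
  gcomp :: "'u \<Rightarrow> 'u \<Rightarrow> 'u"

definition underlying :: "('u, 'w, 's) igpd \<Rightarrow> ('u, 'u) groupoid" where
  "underlying G =
     \<lparr>Mor = carrier (elts G), Ob = carrier (objs G), ini = d0 G, fin = d1 G,
      unit = eps G, cmp = gcomp G\<rparr>"

text \<open>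
  The inverses required by \<^const>\<open>is_groupoid\<close> exist automatically for an internal category:
  the inverse of \<open>a\<close> is \<open>\<epsilon> (d1 a) - a + \<epsilon> (d0 a)\<close>.
\<close>

definition internal_groupoid :: "('w, 's) op_theory \<Rightarrow> ('u, 'w, 's) igpd \<Rightarrow> bool" where
  "internal_groupoid T G \<longleftrightarrow>
     is_groupoid (underlying G) \<and>
     is_gwo T (elts G) \<and> is_gwo T (objs G) \<and>
     d0 G \<in> gwo_hom T (elts G) (objs G) \<and>
     d1 G \<in> gwo_hom T (elts G) (objs G) \<and>
     eps G \<in> gwo_hom T (objs G) (elts G) \<and>
     (\<lambda>(a, b). gcomp G a b)
       \<in> gwo_hom T (gwo_pullback (elts G) (elts G) (d1 G) (d0 G)) (elts G)"

text \<open>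
  Morphisms are pairs of functions, made extensional (arbitrary outside the carriers) so that
  equality of morphisms is equality on the carriers.
\<close>

definition igpd_hom ::
  "('w, 's) op_theory \<Rightarrow> ('u, 'w, 's) igpd \<Rightarrow> ('u, 'w, 's) igpd \<Rightarrow> (('u \<Rightarrow> 'u) \<times> ('u \<Rightarrow> 'u)) set" where
  "igpd_hom T G H =
     {(f1, f0).
        groupoid_morphism (underlying G) (underlying H) (f1, f0) \<and>
        f1 \<in> gwo_hom T (elts G) (elts H) \<and> f1 \<in> extensional (carrier (elts G)) \<and>
        f0 \<in> gwo_hom T (objs G) (objs H) \<and> f0 \<in> extensional (carrier (objs G))}"

definition igpd_id :: "('u, 'w, 's) igpd \<Rightarrow> ('u \<Rightarrow> 'u) \<times> ('u \<Rightarrow> 'u)" where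
  "igpd_id G = ((\<lambda>a \<in> carrier (elts G). a), (\<lambda>x \<in> carrier (objs G). x))"

text \<open>\<open>igpd_compose G g f\<close> is \<open>g\<close> after \<open>f\<close>, where \<open>G\<close> is the domain of \<open>f\<close>.\<close>

definition igpd_compose ::
  "('u, 'w, 's) igpd \<Rightarrow> ('u \<Rightarrow> 'u) \<times> ('u \<Rightarrow> 'u) \<Rightarrow> ('u \<Rightarrow> 'u) \<times> ('u \<Rightarrow> 'u) \<Rightarrow>
   ('u \<Rightarrow> 'u) \<times> ('u \<Rightarrow> 'u)" where
  "igpd_compose G g f =
     (compose (carrier (elts G)) (fst g) (fst f), compose (carrier (objs G)) (snd g) (snd f))"

definition Cov_Cat ::
  "('w, 's) op_theory \<Rightarrow> ('u, 'w, 's) igpd \<Rightarrow>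
   (('u, 'w, 's) igpd \<times> (('u \<Rightarrow> 'u) \<times> ('u \<Rightarrow> 'u)), ('u \<Rightarrow> 'u) \<times> ('u \<Rightarrow> 'u)) category" where
  "Cov_Cat T G =
     \<lparr>Obj = {(H, p). internal_groupoid T H \<and> p \<in> igpd_hom T H G \<and>
                     covering_morphism (underlying H) (underlying G) p},
      Hom = (\<lambda>(H, p) (K, q).
               {f \<in> igpd_hom T H K. covering_morphism (underlying H) (underlying K) f \<and>
                                    igpd_compose H q f = p}),
      Ident = (\<lambda>(H, p). igpd_id H),
      Comp = (\<lambda>(H, p) _ _. igpd_compose H)\<rparr>"


section \<open>Crossed modules and their covers\<close>

text \<open>
  Action data of \<open>B\<close> on \<open>A\<close>: \<open>dot b a\<close> is \<open>b \<cdot> a\<close> and, for \<open>\<beta>\<close> the symbol of \<open>\<star>\<close>,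
  \<open>star \<beta> b a\<close> is \<open>b \<star> a\<close>; \<open>a \<star> b\<close> means \<open>b \<star>\<^sup>\<circ> a\<close>, that is
  \<open>star (opp T \<beta>) b a\<close>. The action is derived if it comes from a split extension in \<open>C\<close>. The kernel is given by an injective morphism \<open>i : A \<rightarrow> E\<close> onto \<open>Ker p\<close>, which the
  informal notation treats as an inclusion. The extension \<open>E\<close> ranges over the objects of \<open>C\<close> in
  the universe \<open>'u\<close>; for infinite \<open>'u\<close> this is no restriction, as \<open>E\<close> is in bijection
  with \<open>A \<times> B\<close>.
\<close>

definition derived_action ::
  "('w, 's) op_theory \<Rightarrow> ('u, 'w, 's) gwo \<Rightarrow> ('u, 'w, 's) gwo \<Rightarrow>
   ('u \<Rightarrow> 'u \<Rightarrow> 'u) \<Rightarrow> ('s \<Rightarrow> 'u \<Rightarrow> 'u \<Rightarrow> 'u) \<Rightarrow> bool" where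
  "derived_action T A B dot star \<longleftrightarrow>
     (\<exists>(E :: ('u, 'w, 's) gwo) i p s.
        is_gwo T E \<and>
        i \<in> gwo_hom T A E \<and> p \<in> gwo_hom T E B \<and> s \<in> gwo_hom T B E \<and>
        inj_on i (carrier A) \<and> i ` carrier A = kernel E B p \<and>
        p ` carrier E = carrier B \<and>
        (\<forall>b \<in> carrier B. p (s b) = b) \<and>
        (\<forall>b \<in> carrier B. \<forall>a \<in> carrier A.
           dot b a \<in> carrier A \<and> i (dot b a) = s b \<otimes>\<^bsub>E\<^esub> i a \<otimes>\<^bsub>E\<^esub> inv\<^bsub>E\<^esub> (s b)) \<and>
        (\<forall>\<beta> \<in> Binary T. \<forall>b \<in> carrier B. \<forall>a \<in> carrier A.
           star \<beta> b a \<in> carrier A \<and> i (star \<beta> b a) = binop E \<beta> (s b) (i a)))"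

text \<open>\<open>xtop\<close> and \<open>xbase\<close> are the domain and codomain of the boundary map \<open>bd : A \<rightarrow> B\<close>.\<close>

record ('u, 'w, 's) xmod =
  xtop :: "('u, 'w, 's) gwo"
  xbase :: "('u, 'w, 's) gwo"
  bd :: "'u \<Rightarrow> 'u"
  dot :: "'u \<Rightarrow> 'u \<Rightarrow> 'u"
  star :: "'s \<Rightarrow> 'u \<Rightarrow> 'u \<Rightarrow> 'u"

definition crossed_module :: "('w, 's) op_theory \<Rightarrow> ('u, 'w, 's) xmod \<Rightarrow> bool" where
  "crossed_module T X \<longleftrightarrow>
     (let A = xtop X; B = xbase X; \<alpha> = bd X in
      is_gwo T A \<and> is_gwo T B \<and> \<alpha> \<in> gwo_hom T A B \<and>
      derived_action T A B (dot X) (star X) \<and>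
      (\<forall>b \<in> carrier B. \<forall>a \<in> carrier A.
         \<alpha> (dot X b a) = b \<otimes>\<^bsub>B\<^esub> \<alpha> a \<otimes>\<^bsub>B\<^esub> inv\<^bsub>B\<^esub> b) \<and>
      (\<forall>a \<in> carrier A. \<forall>a' \<in> carrier A.
         dot X (\<alpha> a) a' = a \<otimes>\<^bsub>A\<^esub> a' \<otimes>\<^bsub>A\<^esub> inv\<^bsub>A\<^esub> a) \<and>
      (\<forall>\<beta> \<in> Binary T. \<forall>a \<in> carrier A. \<forall>a' \<in> carrier A.
         star X \<beta> (\<alpha> a) a' = binop A \<beta> a a') \<and>
      (\<forall>\<beta> \<in> Binary T. \<forall>b \<in> carrier B. \<forall>a \<in> carrier A.
         \<alpha> (star X \<beta> b a) = binop B \<beta> b (\<alpha> a) \<and>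
         \<alpha> (star X (opp T \<beta>) b a) = binop B \<beta> (\<alpha> a) b))"

definition xmod_hom ::
  "('w, 's) op_theory \<Rightarrow> ('u, 'w, 's) xmod \<Rightarrow> ('u, 'w, 's) xmod \<Rightarrow> (('u \<Rightarrow> 'u) \<times> ('u \<Rightarrow> 'u)) set" where
  "xmod_hom T X Y =
     {(f1, f2).
        f1 \<in> gwo_hom T (xtop X) (xtop Y) \<and> f1 \<in> extensional (carrier (xtop X)) \<and>
        f2 \<in> gwo_hom T (xbase X) (xbase Y) \<and> f2 \<in> extensional (carrier (xbase X)) \<and>
        (\<forall>a \<in> carrier (xtop X). f2 (bd X a) = bd Y (f1 a)) \<and>
        (\<forall>b \<in> carrier (xbase X). \<forall>a \<in> carrier (xtop X). f1 (dot X b a) = dot Y (f2 b) (f1 a)) \<and>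
        (\<forall>\<beta> \<in> Binary T. \<forall>b \<in> carrier (xbase X). \<forall>a \<in> carrier (xtop X).
           f1 (star X \<beta> b a) = star Y \<beta> (f2 b) (f1 a))}"

definition xmod_id :: "('u, 'w, 's) xmod \<Rightarrow> ('u \<Rightarrow> 'u) \<times> ('u \<Rightarrow> 'u)" where
  "xmod_id X = ((\<lambda>a \<in> carrier (xtop X). a), (\<lambda>b \<in> carrier (xbase X). b))"

definition xmod_compose ::
  "('u, 'w, 's) xmod \<Rightarrow> ('u \<Rightarrow> 'u) \<times> ('u \<Rightarrow> 'u) \<Rightarrow> ('u \<Rightarrow> 'u) \<times> ('u \<Rightarrow> 'u) \<Rightarrow>
   ('u \<Rightarrow> 'u) \<times> ('u \<Rightarrow> 'u)" where
  "xmod_compose X g f =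
     (compose (carrier (xtop X)) (fst g) (fst f), compose (carrier (xbase X)) (snd g) (snd f))"

definition xmod_cover ::
  "('w, 's) op_theory \<Rightarrow> ('u, 'w, 's) xmod \<Rightarrow> ('u, 'w, 's) xmod \<Rightarrow> ('u \<Rightarrow> 'u) \<times> ('u \<Rightarrow> 'u) \<Rightarrow> bool" where
  "xmod_cover T X Y f \<longleftrightarrow> f \<in> xmod_hom T X Y \<and> fst f \<in> gwo_iso T (xtop X) (xtop Y)"

definition Cov_XMod ::
  "('w, 's) op_theory \<Rightarrow> ('u, 'w, 's) xmod \<Rightarrow>
   (('u, 'w, 's) xmod \<times> (('u \<Rightarrow> 'u) \<times> ('u \<Rightarrow> 'u)), ('u \<Rightarrow> 'u) \<times> ('u \<Rightarrow> 'u)) category" where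
  "Cov_XMod T Y =
     \<lparr>Obj = {(X, p). crossed_module T X \<and> xmod_cover T X Y p},
      Hom = (\<lambda>(X, p) (X', q). {f \<in> xmod_hom T X X'. xmod_compose X q f = p}),
      Ident = (\<lambda>(X, p). xmod_id X),
      Comp = (\<lambda>(X, p) _ _. xmod_compose X)\<rparr>"

definition xmod_of :: "('u, 'w, 's) igpd \<Rightarrow> ('u, 'w, 's) xmod" where
  "xmod_of G =
     \<lparr>xtop = gwo_kernel (elts G) (objs G) (d0 G),
      xbase = objs G,
      bd = d1 G,
      dot = (\<lambda>b a. eps G b \<otimes>\<^bsub>elts G\<^esub> a \<otimes>\<^bsub>elts G\<^esub> inv\<^bsub>elts G\<^esub> (eps G b)),
      star = (\<lambda>\<beta> b a. binop (elts G) \<beta> (eps G b) a)\<rparr>"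

end

theory Submission
  imports Defs
begin

text \<open>
  An internal groupoid \<open>H\<close> is determined by its crossed module. The object inclusion splits \<open>d0\<close>, so
  that every element is uniquely a sum \<open>a + \<epsilon> b\<close> with \<open>a \<in> Ker d0\<close>, and since composition is a morphism
  of \<open>C\<close> it can only be \<open>a \<circ> b = b - \<epsilon> (d0 b) + a\<close> (lemma \<open>gcomp_eq\<close>). A morphism of internal groupoids is
  therefore the same thing as a morphism of the associated crossed modules, obtained by restriction to
  \<open>Ker d0\<close>; and it is a covering morphism exactly when this restriction is bijective, because
  \<open>a \<mapsto> a - \<epsilon> x\<close> identifies the star of any object \<open>x\<close> with the star \<open>Ker d0\<close> of \<open>0\<close> (lemma \<open>covering_iff\<close>).
  So restriction to the kernel is a fully faithful functor from the covers of \<open>G\<close> to the covers of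
  its crossed module. The equivalence follows once every cover of crossed modules is, up to
  isomorphism, in its image.

  For this, let \<open>\<alpha> : A \<rightarrow> B\<close> be a crossed module whose action is derived from a split extension \<open>E\<close> of
  \<open>B\<close> by \<open>A\<close>. The groupoid is built on \<open>E\<close> itself, with \<open>d0\<close> the projection \<open>p : E \<rightarrow> B\<close>, \<open>\<epsilon>\<close> the
  splitting \<open>s\<close>, \<open>d1 (a + s b) = \<alpha> a + b\<close>, and \<open>e \<circ> e' = e' - s (p e') + e\<close>. Taking \<open>E\<close> itself, rather than a
  set of pairs, keeps the construction inside the given universe whatever its size.

  The substantial point is that the three maps used above (the lift of a morphism of crossed modules,
  the target map \<open>d1\<close>, and the composition) are morphisms in \<open>C\<close>. All three are instances of one
  universal property (lemma \<open>glue_morphism\<close>): morphisms \<open>u : A \<rightarrow> Z\<close> and \<open>w : B \<rightarrow> Z\<close> extend to a morphism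
  \<open>E \<rightarrow> Z\<close>, \<open>a + s b \<mapsto> u a + w b\<close>, as soon as \<open>u\<close> turns the actions of \<open>b\<close> into those of \<open>w b\<close> inside \<open>Z\<close>.
  For \<open>d1\<close> the condition is (CM1) and (CM4). For the composition, the composable pairs form a split
  extension of \<open>E\<close> by \<open>A\<close>, with section \<open>e \<mapsto> (e, s (d1 e))\<close>, and the condition is (CM2) and (CM3).
\<close>


section \<open>Fully faithful and essentially surjective functors\<close>

text \<open>
  A quasi-inverse picks for each \<open>Y\<close> a preimage \<open>Go Y\<close> with an isomorphism \<open>u Y : Fo (Go Y) \<rightarrow> Y\<close>, and acts
  on morphisms by conjugating with these isomorphisms and lifting along the bijections on Hom-sets.
  Its required equations hold because they hold after applying the faithful functor.
\<close>

lemma equivalent_categories_if_fully_faithful: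
  assumes C: "is_category C" and D: "is_category D" and F: "is_functor C D Fo Fm"
    and ff: "\<And>X Y. X \<in> Obj C \<Longrightarrow> Y \<in> Obj C \<Longrightarrow>
               bij_betw (Fm X Y) (Hom C X Y) (Hom D (Fo X) (Fo Y))"
    and es: "\<And>Y. Y \<in> Obj D \<Longrightarrow> \<exists>X \<in> Obj C. \<exists>u. is_isomorphism D (Fo X) Y u"
  shows "equivalent_categories C D"
proof -
  note [simp] = C[unfolded is_category_def, THEN conjunct1, rule_format]
    D[unfolded is_category_def, THEN conjunct1, rule_format]
  have Cc [simp]: "Comp C X Y Z g f \<in> Hom C X Z"
    if "X \<in> Obj C" "Y \<in> Obj C" "Z \<in> Obj C" "f \<in> Hom C X Y" "g \<in> Hom C Y Z" for X Y Z f g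
    using C that unfolding is_category_def by blast
  have Dc [simp]: "Comp D X Y Z g f \<in> Hom D X Z"
    if "X \<in> Obj D" "Y \<in> Obj D" "Z \<in> Obj D" "f \<in> Hom D X Y" "g \<in> Hom D Y Z" for X Y Z f g
    using D that unfolding is_category_def by blast
  have Did [simp]: "Comp D X X Y f (Ident D X) = f" "Comp D X Y Y (Ident D Y) f = f"
    if "X \<in> Obj D" "Y \<in> Obj D" "f \<in> Hom D X Y" for X Y f
    using D that unfolding is_category_def by blast+
  have Da: "Comp D W X Z (Comp D X Y Z h g) f = Comp D W Y Z h (Comp D W X Y g f)"
    if "W \<in> Obj D" "X \<in> Obj D" "Y \<in> Obj D" "Z \<in> Obj D"
      "f \<in> Hom D W X" "g \<in> Hom D X Y" "h \<in> Hom D Y Z" for W X Y Z f g h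
    using D that unfolding is_category_def by blast
  have Fo [simp]: "Fo X \<in> Obj D" if "X \<in> Obj C" for X
    using F that unfolding is_functor_def by blast
  have Fm [simp]: "Fm X Y f \<in> Hom D (Fo X) (Fo Y)"
    if "X \<in> Obj C" "Y \<in> Obj C" "f \<in> Hom C X Y" for X Y f
    using F that unfolding is_functor_def by blast
  have Fid [simp]: "Fm X X (Ident C X) = Ident D (Fo X)" if "X \<in> Obj C" for X
    using F that unfolding is_functor_def by blast
  have Fcomp: "Fm X Z (Comp C X Y Z g f) = Comp D (Fo X) (Fo Y) (Fo Z) (Fm Y Z g) (Fm X Y f)"
    if "X \<in> Obj C" "Y \<in> Obj C" "Z \<in> Obj C" "f \<in> Hom C X Y" "g \<in> Hom C Y Z" for X Y Z f g
    using F that unfolding is_functor_def by blast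
  have inj: "f = g" if "X \<in> Obj C" "Y \<in> Obj C" "f \<in> Hom C X Y" "g \<in> Hom C X Y"
    "Fm X Y f = Fm X Y g" for X Y f g
    using ff[of X Y] that unfolding bij_betw_def inj_on_def by blast
  \<comment> \<open>\<open>L\<close> lifts morphisms along the bijections on Hom-sets.\<close>
  define L where "L X Y = inv_into (Hom C X Y) (Fm X Y)" for X Y
  have L [simp]: "L X Y g \<in> Hom C X Y" "Fm X Y (L X Y g) = g"
    if "X \<in> Obj C" "Y \<in> Obj C" "g \<in> Hom D (Fo X) (Fo Y)" for X Y g
    using ff[of X Y] that unfolding L_def
    by (metis bij_betw_def inv_into_into, metis bij_betw_inv_into_right)
  have "\<exists>X u v. X \<in> Obj C \<and> u \<in> Hom D (Fo X) Y \<and> v \<in> Hom D Y (Fo X) \<and>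
          Comp D (Fo X) Y (Fo X) v u = Ident D (Fo X) \<and> Comp D Y (Fo X) Y u v = Ident D Y"
    if "Y \<in> Obj D" for Y
    using es[OF that] unfolding is_isomorphism_def by blast
  then obtain Go u v where
    Go [simp]: "\<And>Y. Y \<in> Obj D \<Longrightarrow> Go Y \<in> Obj C"
    and u [simp]: "\<And>Y. Y \<in> Obj D \<Longrightarrow> u Y \<in> Hom D (Fo (Go Y)) Y"
    and v [simp]: "\<And>Y. Y \<in> Obj D \<Longrightarrow> v Y \<in> Hom D Y (Fo (Go Y))"
    and vu [simp]: "\<And>Y. Y \<in> Obj D \<Longrightarrow>
                      Comp D (Fo (Go Y)) Y (Fo (Go Y)) (v Y) (u Y) = Ident D (Fo (Go Y))"
    and uv [simp]: "\<And>Y. Y \<in> Obj D \<Longrightarrow> Comp D Y (Fo (Go Y)) Y (u Y) (v Y) = Ident D Y"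
    by metis
  define Gm where "Gm Y Z g = L (Go Y) (Go Z)
      (Comp D (Fo (Go Y)) Z (Fo (Go Z)) (v Z) (Comp D (Fo (Go Y)) Y Z g (u Y)))" for Y Z g
  have Gm [simp]: "Gm Y Z g \<in> Hom C (Go Y) (Go Z)"
    "Fm (Go Y) (Go Z) (Gm Y Z g) =
       Comp D (Fo (Go Y)) Z (Fo (Go Z)) (v Z) (Comp D (Fo (Go Y)) Y Z g (u Y))"
    if "Y \<in> Obj D" "Z \<in> Obj D" "g \<in> Hom D Y Z" for Y Z g
    using that by (simp_all add: Gm_def)
  have v_cancel: "Comp D W (Fo (Go Z)) Z (u Z) (Comp D W Z (Fo (Go Z)) (v Z) f) = f"
    if "W \<in> Obj D" "Z \<in> Obj D" "f \<in> Hom D W Z" for W Z f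
    using that by (simp flip: Da)
  have u_cancel: "Comp D W Z (Fo (Go Z)) (v Z) (Comp D W (Fo (Go Z)) Z (u Z) f) = f"
    if "W \<in> Obj D" "Z \<in> Obj D" "f \<in> Hom D W (Fo (Go Z))" for W Z f
    using that by (simp flip: Da)
  have G: "is_functor D C Go Gm"
    unfolding is_functor_def
  proof (intro conjI ballI)
    fix X assume "X \<in> Obj D"
    then show "Gm X X (Ident D X) = Ident C (Go X)"
      by (intro inj[of "Go X" "Go X"]) simp_all
  next
    fix X Y Z f g assume *: "X \<in> Obj D" "Y \<in> Obj D" "Z \<in> Obj D" "f \<in> Hom D X Y" "g \<in> Hom D Y Z"
    show "Gm X Z (Comp D X Y Z g f) = Comp C (Go X) (Go Y) (Go Z) (Gm Y Z g) (Gm X Y f)"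
    proof (intro inj[of "Go X" "Go Z"])
      show "Fm (Go X) (Go Z) (Gm X Z (Comp D X Y Z g f)) =
            Fm (Go X) (Go Z) (Comp C (Go X) (Go Y) (Go Z) (Gm Y Z g) (Gm X Y f))"
        using * by (simp add: Fcomp Da v_cancel)
    qed (use * in auto)
  qed auto
  \<comment> \<open>The unit at \<open>X\<close> is the lift of the inverse of the isomorphism chosen for \<open>Fo X\<close>.\<close>
  define \<eta> where "\<eta> X = L X (Go (Fo X)) (v (Fo X))" for X
  have \<eta>: "\<eta> X \<in> Hom C X (Go (Fo X))" "Fm X (Go (Fo X)) (\<eta> X) = v (Fo X)" if "X \<in> Obj C" for X
    using that by (simp_all add: \<eta>_def)
  have "is_natural_isomorphism C C (\<lambda>X. X) (\<lambda>X Y f. f)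
          (\<lambda>X. Go (Fo X)) (\<lambda>X Y f. Gm (Fo X) (Fo Y) (Fm X Y f)) \<eta>"
    unfolding is_natural_isomorphism_def is_isomorphism_def
  proof (intro conjI ballI)
    fix X assume X: "X \<in> Obj C"
    show "\<exists>g\<in>Hom C (Go (Fo X)) X. Comp C X (Go (Fo X)) X g (\<eta> X) = Ident C X \<and>
            Comp C (Go (Fo X)) X (Go (Fo X)) (\<eta> X) g = Ident C (Go (Fo X))"
    proof (intro bexI[of _ "L (Go (Fo X)) X (u (Fo X))"] conjI)
      show "Comp C X (Go (Fo X)) X (L (Go (Fo X)) X (u (Fo X))) (\<eta> X) = Ident C X"
        by (rule inj[of X X]) (use X \<eta> in \<open>simp_all add: Fcomp\<close>)
      show "Comp C (Go (Fo X)) X (Go (Fo X)) (\<eta> X) (L (Go (Fo X)) X (u (Fo X))) =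
            Ident C (Go (Fo X))"
        by (rule inj[of "Go (Fo X)" "Go (Fo X)"]) (use X \<eta> in \<open>simp_all add: Fcomp\<close>)
    qed (use X in auto)
  next
    fix X Y f assume *: "X \<in> Obj C" "Y \<in> Obj C" "f \<in> Hom C X Y"
    show "Comp C X (Go (Fo X)) (Go (Fo Y)) (Gm (Fo X) (Fo Y) (Fm X Y f)) (\<eta> X) =
          Comp C X Y (Go (Fo Y)) (\<eta> Y) f"
      by (rule inj[of X "Go (Fo Y)"]) (use * \<eta> in \<open>simp_all add: Fcomp Da\<close>)
  qed (use \<eta> in auto)
  moreover have "is_natural_isomorphism D D (\<lambda>X. Fo (Go X))
      (\<lambda>X Y f. Fm (Go X) (Go Y) (Gm X Y f)) (\<lambda>X. X) (\<lambda>X Y f. f) u"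
    unfolding is_natural_isomorphism_def is_isomorphism_def
  proof (intro conjI ballI)
    fix Y assume "Y \<in> Obj D"
    then show "\<exists>g\<in>Hom D Y (Fo (Go Y)). Comp D (Fo (Go Y)) Y (Fo (Go Y)) g (u Y) = Ident D (Fo (Go Y)) \<and>
        Comp D Y (Fo (Go Y)) Y (u Y) g = Ident D Y"
      by (intro bexI[of _ "v Y"]) simp_all
  qed (simp_all add: v_cancel)
  ultimately show ?thesis
    unfolding equivalent_categories_def using C D F G by blast
qed


section \<open>Groups with operations and their morphisms\<close>

locale gwo = group X for T :: "('w, 's) op_theory" and X :: "('a, 'w, 's) gwo" (structure) +
  assumes ops_theory: "groups_with_operations_theory T"
    and is_gwo: "is_gwo T X"
begin

lemma identity:
  "(l, r) \<in> Identities T \<Longrightarrow> (\<And>n. v n \<in> carrier X) \<Longrightarrow> eval_term X v l = eval_term X v r"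
  using is_gwo unfolding is_gwo_def by fastforce

lemma unop_closed [simp]: "\<omega> \<in> Unary T \<Longrightarrow> x \<in> carrier X \<Longrightarrow> unop X \<omega> x \<in> carrier X"
  using is_gwo unfolding is_gwo_def by blast

lemma binop_closed [simp]:
  "\<beta> \<in> Binary T \<Longrightarrow> x \<in> carrier X \<Longrightarrow> y \<in> carrier X \<Longrightarrow> binop X \<beta> x y \<in> carrier X"
  using is_gwo unfolding is_gwo_def by blast

lemma opp_closed [simp]: "\<beta> \<in> Binary T \<Longrightarrow> opp T \<beta> \<in> Binary T"
  using ops_theory unfolding groups_with_operations_theory_def by blast

lemma unop_mult [simp]:
  assumes "\<omega> \<in> Unary T" "x \<in> carrier X" "y \<in> carrier X"
  shows "unop X \<omega> (x \<otimes> y) = unop X \<omega> x \<otimes> unop X \<omega> y"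
  using identity[of "UnOp \<omega> (Plus (V 0) (V 1))" "Plus (UnOp \<omega> (V 0)) (UnOp \<omega> (V 1))"
      "\<lambda>n. if n = 0 then x else y"] ops_theory assms
  unfolding groups_with_operations_theory_def by force

lemma unop_one [simp]: "\<omega> \<in> Unary T \<Longrightarrow> unop X \<omega> \<one> = \<one>"
  using unop_mult[of \<omega> \<one> \<one>] by (simp del: unop_mult)

lemma binop_opp [simp]:
  assumes "\<beta> \<in> Binary T" "x \<in> carrier X" "y \<in> carrier X"
  shows "binop X (opp T \<beta>) x y = binop X \<beta> y x"
  using identity[of "BinOp (opp T \<beta>) (V 0) (V 1)" "BinOp \<beta> (V 1) (V 0)"
      "\<lambda>n. if n = 0 then x else y"] ops_theory assms
  unfolding groups_with_operations_theory_def by force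

lemma binop_mult_right [simp]:
  assumes "\<beta> \<in> Binary T" "x \<in> carrier X" "y \<in> carrier X" "z \<in> carrier X"
  shows "binop X \<beta> x (y \<otimes> z) = binop X \<beta> x y \<otimes> binop X \<beta> x z"
  using identity[of "BinOp \<beta> (V 0) (Plus (V 1) (V 2))"
      "Plus (BinOp \<beta> (V 0) (V 1)) (BinOp \<beta> (V 0) (V 2))"
      "\<lambda>n. if n = 0 then x else if n = 1 then y else z"] ops_theory assms
  unfolding groups_with_operations_theory_def by force

text \<open>
  Left distributivity is imposed by the axioms; right distributivity is left distributivity of the
  opposite operation.
\<close>

lemma binop_mult_left [simp]:
  assumes "\<beta> \<in> Binary T" "x \<in> carrier X" "y \<in> carrier X" "z \<in> carrier X"
  shows "binop X \<beta> (y \<otimes> z) x = binop X \<beta> y x \<otimes> binop X \<beta> z x"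
  using binop_mult_right[of "opp T \<beta>" x y z] assms by (simp del: binop_mult_right)

lemma binop_one [simp]:
  assumes "\<beta> \<in> Binary T" "x \<in> carrier X"
  shows "binop X \<beta> x \<one> = \<one>" "binop X \<beta> \<one> x = \<one>"
  using binop_mult_right[of \<beta> x \<one> \<one>] binop_mult_left[of \<beta> x \<one> \<one>] assms
  by (simp_all del: binop_mult_right binop_mult_left)

lemma mult_inv_cancel [simp]:
  assumes "x \<in> carrier X" "y \<in> carrier X"
  shows "x \<otimes> (inv x \<otimes> y) = y" "inv x \<otimes> (x \<otimes> y) = y"
  using assms by (simp_all flip: m_assoc)

end

lemma gwoI: "groups_with_operations_theory T \<Longrightarrow> is_gwo T X \<Longrightarrow> gwo T X"
  by (simp add: gwo_def gwo_axioms_def is_gwo_def)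

locale gwo_morphism = X: gwo T X + Y: gwo T Y
  for T :: "('w, 's) op_theory" and X :: "('a, 'w, 's) gwo" and Y :: "('b, 'w, 's) gwo" +
  fixes f
  assumes hom: "f \<in> gwo_hom T X Y"
begin

sublocale group_hom X Y f
  using hom by unfold_locales (simp add: gwo_hom_def)

lemma hom_unop [simp]: "\<omega> \<in> Unary T \<Longrightarrow> x \<in> carrier X \<Longrightarrow> f (unop X \<omega> x) = unop Y \<omega> (f x)"
  using hom by (simp add: gwo_hom_def)

lemma hom_binop [simp]:
  "\<beta> \<in> Binary T \<Longrightarrow> x \<in> carrier X \<Longrightarrow> y \<in> carrier X \<Longrightarrow>
     f (binop X \<beta> x y) = binop Y \<beta> (f x) (f y)"
  using hom by (simp add: gwo_hom_def)

text \<open>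
  Identities are inherited by the kernel, since it is closed under all operations and well-formed
  terms are evaluated in it as in the ambient object.
\<close>

lemma kernel_gwo: "is_gwo T (gwo_kernel X Y f)"
proof -
  let ?K = "gwo_kernel X Y f"
  have sub: "subgroup (kernel X Y f) X" by (rule subgroup_kernel)
  have K: "carrier ?K = kernel X Y f" "(\<otimes>\<^bsub>?K\<^esub>) = (\<otimes>\<^bsub>X\<^esub>)" "\<one>\<^bsub>?K\<^esub> = \<one>\<^bsub>X\<^esub>"
    "unop ?K = unop X" "binop ?K = binop X"
    by (simp_all add: gwo_kernel_def)
  have inv: "inv\<^bsub>?K\<^esub> x = inv\<^bsub>X\<^esub> x" if "x \<in> kernel X Y f" for x
    using X.m_inv_consistent[OF sub that] by (simp add: gwo_kernel_def m_inv_def)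
  have grp: "group ?K"
    using X.subgroup_imp_group[OF sub]
    unfolding group_def monoid_def group_axioms_def Units_def K by simp
  have ev: "eval_term ?K v t \<in> kernel X Y f \<and> eval_term ?K v t = eval_term X v t"
    if "wf_term T t" "\<And>n. v n \<in> kernel X Y f" for v t
    using that(1)
  proof (induction t)
    case (V n) then show ?case using that by simp
  next
    case Zero then show ?case by (simp add: K kernel_def)
  next
    case (Neg t) then show ?case by (auto simp: inv K kernel_def)
  next
    case (Plus t u) then show ?case by (auto simp: K kernel_def)
  next
    case (UnOp \<omega> t) then show ?case by (auto simp: K kernel_def)
  next
    case (BinOp \<beta> t u) then show ?case by (auto simp: K kernel_def)
  qed
  have un: "unop X \<omega> x \<in> kernel X Y f" if "\<omega> \<in> Unary T" "x \<in> kernel X Y f" for \<omega> x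
    using ev[of "UnOp \<omega> (V 0)" "\<lambda>_. x"] that by (simp add: K)
  have bin: "binop X \<beta> x y \<in> kernel X Y f"
    if "\<beta> \<in> Binary T" "x \<in> kernel X Y f" "y \<in> kernel X Y f" for \<beta> x y
    using ev[of "BinOp \<beta> (V 0) (V 1)" "\<lambda>n. if n = 0 then x else y"] that by (simp add: K)
  have "eval_term ?K v l = eval_term ?K v r"
    if "(l, r) \<in> Identities T" "v \<in> UNIV \<rightarrow> kernel X Y f" for l r v
  proof -
    have "wf_term T l" "wf_term T r"
      using X.ops_theory that(1) unfolding groups_with_operations_theory_def by auto
    moreover have "v n \<in> kernel X Y f" "v n \<in> carrier X" for n
      using that(2) by (auto simp: kernel_def)
    ultimately show ?thesis
      using ev[of l v] ev[of r v] X.identity[OF that(1), of v] by simp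
  qed
  then show ?thesis
    unfolding is_gwo_def K using grp un bin by auto
qed

end

lemma gwo_morphismI: "gwo T X \<Longrightarrow> gwo T Y \<Longrightarrow> f \<in> gwo_hom T X Y \<Longrightarrow> gwo_morphism T X Y f"
  by (simp add: gwo_morphism_def gwo_morphism_axioms_def)

lemma gwo_homI:
  assumes "\<And>x. x \<in> carrier X \<Longrightarrow> f x \<in> carrier Y"
    "\<And>x y. x \<in> carrier X \<Longrightarrow> y \<in> carrier X \<Longrightarrow> f (x \<otimes>\<^bsub>X\<^esub> y) = f x \<otimes>\<^bsub>Y\<^esub> f y"
    "\<And>\<omega> x. \<omega> \<in> Unary T \<Longrightarrow> x \<in> carrier X \<Longrightarrow> f (unop X \<omega> x) = unop Y \<omega> (f x)"
    "\<And>\<beta> x y. \<beta> \<in> Binary T \<Longrightarrow> x \<in> carrier X \<Longrightarrow> y \<in> carrier X \<Longrightarrow>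
       f (binop X \<beta> x y) = binop Y \<beta> (f x) (f y)"
  shows "f \<in> gwo_hom T X Y"
  using assms by (auto simp: gwo_hom_def hom_def)

lemma gwo_isoI:
  assumes "gwo T X" "gwo T Y" "f \<in> gwo_hom T X Y" and bij: "bij_betw f (carrier X) (carrier Y)"
  shows "f \<in> gwo_iso T X Y"
    "inv_into (carrier X) f \<in> gwo_hom T Y X"
proof -
  interpret gwo_morphism T X Y f using assms(1-3) by (rule gwo_morphismI)
  let ?g = "inv_into (carrier X) f"
  have fg [simp]: "?g y \<in> carrier X" "f (?g y) = y" if "y \<in> carrier Y" for y
    using that bij by (metis bij_betw_def inv_into_into, metis bij_betw_inv_into_right)
  have gf [simp]: "?g (f x) = x" if "x \<in> carrier X" for x
    using that bij by (metis bij_betw_inv_into_left)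
  have eq: "?g y = x" if "x \<in> carrier X" "f x = y" for x y
    using that by auto
  show "?g \<in> gwo_hom T Y X"
    by (rule gwo_homI) (simp_all add: eq)
  with hom show "f \<in> gwo_iso T X Y"
    unfolding gwo_iso_def by (intro CollectI conjI bexI[of _ ?g]) auto
qed

lemma gwo_iso_bij:
  assumes "f \<in> gwo_iso T X Y"
  shows "bij_betw f (carrier X) (carrier Y)"
proof -
  obtain g where "g \<in> gwo_hom T Y X" "f \<in> gwo_hom T X Y"
    "\<forall>x \<in> carrier X. g (f x) = x" "\<forall>y \<in> carrier Y. f (g y) = y"
    using assms unfolding gwo_iso_def by blast
  then show ?thesis
    by (intro bij_betwI[where g = g]) (auto simp: gwo_hom_def hom_def)
qed

lemma pullback_gwo:
  assumes "gwo_morphism T X Z f" "gwo_morphism T Y Z g"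
  shows "gwo T (gwo_pullback X Y f g)"
proof -
  interpret f: gwo_morphism T X Z f by fact
  interpret g: gwo_morphism T Y Z g by fact
  interpret Y: gwo T Y by (rule g.X.gwo_axioms)
  let ?P = "gwo_pullback X Y f g"
  have P: "carrier ?P = {(x, y). x \<in> carrier X \<and> y \<in> carrier Y \<and> f x = g y}"
    "\<And>a b. a \<otimes>\<^bsub>?P\<^esub> b = (fst a \<otimes>\<^bsub>X\<^esub> fst b, snd a \<otimes>\<^bsub>Y\<^esub> snd b)" "\<one>\<^bsub>?P\<^esub> = (\<one>\<^bsub>X\<^esub>, \<one>\<^bsub>Y\<^esub>)"
    "\<And>\<omega> a. unop ?P \<omega> a = (unop X \<omega> (fst a), unop Y \<omega> (snd a))"
    "\<And>\<beta> a b. binop ?P \<beta> a b = (binop X \<beta> (fst a) (fst b), binop Y \<beta> (snd a) (snd b))"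
    by (auto simp: gwo_pullback_def split: prod.splits)
  have grp: "group ?P"
  proof (rule groupI)
    fix a assume "a \<in> carrier ?P"
    then show "\<exists>b \<in> carrier ?P. b \<otimes>\<^bsub>?P\<^esub> a = \<one>\<^bsub>?P\<^esub>"
      by (intro bexI[of _ "(inv\<^bsub>X\<^esub> fst a, inv\<^bsub>Y\<^esub> snd a)"]) (auto simp: P)
  qed (auto simp: P f.X.m_assoc g.X.m_assoc)
  have inv: "inv\<^bsub>?P\<^esub> a = (inv\<^bsub>X\<^esub> fst a, inv\<^bsub>Y\<^esub> snd a)" if "a \<in> carrier ?P" for a
    using that by (intro group.inv_equality[OF grp]) (auto simp: P)
  have ev: "eval_term ?P v t \<in> carrier ?P \<and>
       eval_term ?P v t = (eval_term X (fst \<circ> v) t, eval_term Y (snd \<circ> v) t)"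
    if "wf_term T t" "\<And>n. v n \<in> carrier ?P" for v t
    using that(1)
  proof (induction t)
    case (V n) then show ?case using that by simp
  next
    case (Neg t) then show ?case by (auto simp: inv) (auto simp: P)
  qed (auto simp: P)
  have "eval_term ?P v l = eval_term ?P v r"
    if "(l, r) \<in> Identities T" "v \<in> UNIV \<rightarrow> carrier ?P" for l r v
  proof -
    have "wf_term T l" "wf_term T r"
      using f.X.ops_theory that(1) unfolding groups_with_operations_theory_def by auto
    moreover have v: "v n \<in> carrier ?P" for n
      using that(2) by auto
    moreover have "fst (v n) \<in> carrier X \<and> snd (v n) \<in> carrier Y" for n
      using v[of n] by (auto simp: P)
    ultimately show ?thesis
      using ev[of l v] ev[of r v] f.X.identity[OF that(1), of "fst \<circ> v"]
        g.X.identity[OF that(1), of "snd \<circ> v"] by simp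
  qed
  then have "is_gwo T ?P"
    unfolding is_gwo_def using grp by (auto simp: P)
  then show ?thesis
    using f.X.ops_theory by (rule gwoI[rotated])
qed

lemma gwo_morphism_id: "gwo T X \<Longrightarrow> gwo_morphism T X X (\<lambda>x. x)"
  by (intro gwo_morphismI gwo_homI) auto

lemma gwo_morphism_comp:
  assumes "gwo_morphism T X Y f" "gwo_morphism T Y Z g"
  shows "gwo_morphism T X Z (\<lambda>x. g (f x))"
proof -
  interpret f: gwo_morphism T X Y f by fact
  interpret g: gwo_morphism T Y Z g by fact
  show ?thesis
    by (intro gwo_morphismI f.X.gwo_axioms g.Y.gwo_axioms gwo_homI) simp_all
qed

text \<open>
  Hom-sets of \<open>C\<close> constrain a map only on the carrier, which lets an extensional map inherit the
  homomorphism property from an unrestricted formula for it.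
\<close>

lemma gwo_hom_cong:
  assumes "gwo_morphism T X Y f" and eq: "\<And>x. x \<in> carrier X \<Longrightarrow> g x = f x"
  shows "g \<in> gwo_hom T X Y"
proof -
  interpret gwo_morphism T X Y f by fact
  show ?thesis by (rule gwo_homI) (simp_all add: eq)
qed

lemma gwo_kernel_simps [simp]:
  "carrier (gwo_kernel X Y f) = kernel X Y f" "x \<otimes>\<^bsub>gwo_kernel X Y f\<^esub> y = x \<otimes>\<^bsub>X\<^esub> y"
  "\<one>\<^bsub>gwo_kernel X Y f\<^esub> = \<one>\<^bsub>X\<^esub>"
  "unop (gwo_kernel X Y f) = unop X" "binop (gwo_kernel X Y f) = binop X"
  by (simp_all add: gwo_kernel_def)

lemma gwo_pullback_simps [simp]:
  "x \<in> carrier (gwo_pullback X Y f g) \<longleftrightarrow>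
     fst x \<in> carrier X \<and> snd x \<in> carrier Y \<and> f (fst x) = g (snd x)"
  "x \<otimes>\<^bsub>gwo_pullback X Y f g\<^esub> y = (fst x \<otimes>\<^bsub>X\<^esub> fst y, snd x \<otimes>\<^bsub>Y\<^esub> snd y)"
  "\<one>\<^bsub>gwo_pullback X Y f g\<^esub> = (\<one>\<^bsub>X\<^esub>, \<one>\<^bsub>Y\<^esub>)"
  "unop (gwo_pullback X Y f g) \<omega> x = (unop X \<omega> (fst x), unop Y \<omega> (snd x))"
  "binop (gwo_pullback X Y f g) \<beta> x y = (binop X \<beta> (fst x) (fst y), binop Y \<beta> (snd x) (snd y))"
  by (auto simp: gwo_pullback_def split: prod.splits)


section \<open>Split extensions\<close>

text \<open>
  The data of a derived action: \<open>act\<close> and \<open>sact\<close> are the actions on \<open>A\<close> that conjugation and the binary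
  operations of \<open>E\<close> induce along the splitting \<open>s\<close>. Since \<open>sact\<close> also covers the opposite operations, it
  records \<open>a \<star> b\<close> as well as \<open>b \<star> a\<close>. The three carriers may lie in different types because the
  extension of composable pairs used below lives in a product type.
\<close>

locale split_extension =
  A: gwo T A + B: gwo T B + E: gwo T E +
  i: gwo_morphism T A E i + p: gwo_morphism T E B p + s: gwo_morphism T B E s
  for T :: "('w, 's) op_theory" and A :: "('a, 'w, 's) gwo" and B :: "('b, 'w, 's) gwo"
    and E :: "('e, 'w, 's) gwo" and i p s +
  fixes act :: "'b \<Rightarrow> 'a \<Rightarrow> 'a" and sact :: "'s \<Rightarrow> 'b \<Rightarrow> 'a \<Rightarrow> 'a"
  assumes i_inj: "inj_on i (carrier A)"
    and i_image: "i ` carrier A = kernel E B p"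
    and section_eq [simp]: "b \<in> carrier B \<Longrightarrow> p (s b) = b"
    and act_closed [simp]: "b \<in> carrier B \<Longrightarrow> a \<in> carrier A \<Longrightarrow> act b a \<in> carrier A"
    and i_act [simp]: "b \<in> carrier B \<Longrightarrow> a \<in> carrier A \<Longrightarrow>
          i (act b a) = s b \<otimes>\<^bsub>E\<^esub> i a \<otimes>\<^bsub>E\<^esub> inv\<^bsub>E\<^esub> (s b)"
    and sact_closed [simp]: "\<beta> \<in> Binary T \<Longrightarrow> b \<in> carrier B \<Longrightarrow> a \<in> carrier A \<Longrightarrow>
          sact \<beta> b a \<in> carrier A"
    and i_sact [simp]: "\<beta> \<in> Binary T \<Longrightarrow> b \<in> carrier B \<Longrightarrow> a \<in> carrier A \<Longrightarrow>
          i (sact \<beta> b a) = binop E \<beta> (s b) (i a)"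
begin

lemma i_eqD: "i a = i a' \<Longrightarrow> a \<in> carrier A \<Longrightarrow> a' \<in> carrier A \<Longrightarrow> a = a'"
  using i_inj by (rule inj_onD)

lemma p_i [simp]: "a \<in> carrier A \<Longrightarrow> p (i a) = \<one>\<^bsub>B\<^esub>"
  using i_image by (auto simp: kernel_def)

text \<open>
  The \<open>A\<close>-component of \<open>e\<close> in the normal form \<open>e = i a + s b\<close>, where \<open>b = p e\<close>.
\<close>

definition coord :: "'e \<Rightarrow> 'a" where
  "coord e = inv_into (carrier A) i (e \<otimes>\<^bsub>E\<^esub> inv\<^bsub>E\<^esub> (s (p e)))"

lemma coord:
  assumes "e \<in> carrier E"
  shows coord_closed [simp]: "coord e \<in> carrier A"
    and i_coord [simp]: "i (coord e) = e \<otimes>\<^bsub>E\<^esub> inv\<^bsub>E\<^esub> (s (p e))"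
proof -
  have "e \<otimes>\<^bsub>E\<^esub> inv\<^bsub>E\<^esub> (s (p e)) \<in> i ` carrier A"
    using assms by (simp add: i_image kernel_def)
  then show "coord e \<in> carrier A" "i (coord e) = e \<otimes>\<^bsub>E\<^esub> inv\<^bsub>E\<^esub> (s (p e))"
    unfolding coord_def by (rule inv_into_into, rule f_inv_into_f)
qed

lemma coord_eqI:
  "a \<in> carrier A \<Longrightarrow> e \<in> carrier E \<Longrightarrow> i a \<otimes>\<^bsub>E\<^esub> s (p e) = e \<Longrightarrow> coord e = a"
  by (rule i_eqD) (simp_all add: E.inv_solve_right')

lemma decomposition: "e \<in> carrier E \<Longrightarrow> i (coord e) \<otimes>\<^bsub>E\<^esub> s (p e) = e"
  by (simp add: E.m_assoc)

lemma coord_i [simp]: "a \<in> carrier A \<Longrightarrow> coord (i a) = a"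
  by (rule coord_eqI) simp_all

lemma coord_s [simp]: "b \<in> carrier B \<Longrightarrow> coord (s b) = \<one>\<^bsub>A\<^esub>"
  by (rule coord_eqI) simp_all

lemma coord_mult [simp]:
  assumes "e \<in> carrier E" "e' \<in> carrier E"
  shows "coord (e \<otimes>\<^bsub>E\<^esub> e') = coord e \<otimes>\<^bsub>A\<^esub> act (p e) (coord e')"
  using assms by (intro coord_eqI) (simp_all add: E.m_assoc)

lemma coord_unop [simp]:
  assumes "\<omega> \<in> Unary T" "e \<in> carrier E"
  shows "coord (unop E \<omega> e) = unop A \<omega> (coord e)"
proof (rule coord_eqI)
  have "i (unop A \<omega> (coord e)) \<otimes>\<^bsub>E\<^esub> s (p (unop E \<omega> e)) = unop E \<omega> (i (coord e) \<otimes>\<^bsub>E\<^esub> s (p e))"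
    using assms by (simp del: i_coord)
  then show "i (unop A \<omega> (coord e)) \<otimes>\<^bsub>E\<^esub> s (p (unop E \<omega> e)) = unop E \<omega> e"
    using assms by (simp only: decomposition)
qed (use assms in simp_all)

text \<open>
  Expanding \<open>(i a + s b) \<star> (i a' + s b')\<close> by distributivity gives four terms, of which \<open>s b \<star> s b'\<close> is
  the \<open>B\<close>-component and the other three lie in the kernel.
\<close>

lemma coord_binop [simp]:
  assumes \<beta>: "\<beta> \<in> Binary T" and e: "e \<in> carrier E" "e' \<in> carrier E"
  shows "coord (binop E \<beta> e e') =
    binop A \<beta> (coord e) (coord e') \<otimes>\<^bsub>A\<^esub> sact \<beta> (p e) (coord e') \<otimes>\<^bsub>A\<^esub>
    sact (opp T \<beta>) (p e') (coord e)" (is "_ = ?a")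
proof (rule coord_eqI)
  have "i ?a \<otimes>\<^bsub>E\<^esub> s (p (binop E \<beta> e e')) =
    binop E \<beta> (i (coord e) \<otimes>\<^bsub>E\<^esub> s (p e)) (i (coord e') \<otimes>\<^bsub>E\<^esub> s (p e'))"
    using \<beta> e by (simp add: E.m_assoc del: i_coord)
  then show "i ?a \<otimes>\<^bsub>E\<^esub> s (p (binop E \<beta> e e')) = binop E \<beta> e e'"
    using e by (simp add: decomposition del: i_coord)
qed (use \<beta> e in simp_all)

lemma hom_eqI:
  assumes "gwo_morphism T E Z f" "gwo_morphism T E Z g"
    and "\<And>a. a \<in> carrier A \<Longrightarrow> f (i a) = g (i a)" "\<And>b. b \<in> carrier B \<Longrightarrow> f (s b) = g (s b)"
    and e: "e \<in> carrier E"
  shows "f e = g e"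
proof -
  interpret f: gwo_morphism T E Z f by fact
  interpret g: gwo_morphism T E Z g by fact
  have "f (i (coord e) \<otimes>\<^bsub>E\<^esub> s (p e)) = g (i (coord e) \<otimes>\<^bsub>E\<^esub> s (p e))"
    using e assms(3,4) by (simp del: i_coord)
  then show ?thesis using e by (simp only: decomposition)
qed

text \<open>
  The only candidate for a morphism on \<open>E\<close> with prescribed values \<open>u\<close> on \<open>A\<close> and \<open>w\<close> on \<open>B\<close>.
\<close>

definition glue :: "('z, 'w, 's) gwo \<Rightarrow> ('a \<Rightarrow> 'z) \<Rightarrow> ('b \<Rightarrow> 'z) \<Rightarrow> 'e \<Rightarrow> 'z" where
  "glue Z u w e = u (coord e) \<otimes>\<^bsub>Z\<^esub> w (p e)"

context
  fixes Z u w
  assumes u: "gwo_morphism T A Z u" and w: "gwo_morphism T B Z w"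
begin

interpretation u: gwo_morphism T A Z u by (rule u)
interpretation w: gwo_morphism T B Z w by (rule w)

lemma glue_i [simp]: "a \<in> carrier A \<Longrightarrow> glue Z u w (i a) = u a"
  by (simp add: glue_def)

lemma glue_s [simp]: "b \<in> carrier B \<Longrightarrow> glue Z u w (s b) = w b"
  by (simp add: glue_def)

text \<open>
  The universal property of a split extension as a semidirect product. The two hypotheses are
  exactly what is needed to move \<open>w b\<close> past \<open>u a\<close> in a sum, and to evaluate the mixed terms in the
  expansion of a binary operation; the mixed terms with \<open>u a\<close> on the left are handled by the opposite
  operation.
\<close>

lemma glue_morphism:
  assumes act: "\<And>b a. b \<in> carrier B \<Longrightarrow> a \<in> carrier A \<Longrightarrow>
      u (act b a) = w b \<otimes>\<^bsub>Z\<^esub> u a \<otimes>\<^bsub>Z\<^esub> inv\<^bsub>Z\<^esub> (w b)"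
    and sact: "\<And>\<beta> b a. \<beta> \<in> Binary T \<Longrightarrow> b \<in> carrier B \<Longrightarrow> a \<in> carrier A \<Longrightarrow>
      u (sact \<beta> b a) = binop Z \<beta> (w b) (u a)"
  shows "gwo_morphism T E Z (glue Z u w)"
proof (intro gwo_morphismI E.gwo_axioms u.Y.gwo_axioms gwo_homI)
  fix \<beta> x y assume "\<beta> \<in> Binary T" "x \<in> carrier E" "y \<in> carrier E"
  then show "glue Z u w (binop E \<beta> x y) = binop Z \<beta> (glue Z u w x) (glue Z u w y)"
    by (simp add: glue_def sact u.Y.m_assoc)
qed (simp_all add: glue_def act u.Y.m_assoc)

end

end

lemma derived_action_split_extension:
  fixes A :: "('u, 'w, 's) gwo"
  assumes "groups_with_operations_theory T" "is_gwo T A" "is_gwo T B"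
    and "derived_action T A B act sact"
  obtains E :: "('u, 'w, 's) gwo" and i p s where "split_extension T A B E i p s act sact"
proof -
  obtain E :: "('u, 'w, 's) gwo" and i p s where *: "is_gwo T E"
    "i \<in> gwo_hom T A E" "p \<in> gwo_hom T E B" "s \<in> gwo_hom T B E"
    and **: "inj_on i (carrier A)" "i ` carrier A = kernel E B p"
    "\<forall>b \<in> carrier B. p (s b) = b"
    "\<forall>b \<in> carrier B. \<forall>a \<in> carrier A.
       act b a \<in> carrier A \<and> i (act b a) = s b \<otimes>\<^bsub>E\<^esub> i a \<otimes>\<^bsub>E\<^esub> inv\<^bsub>E\<^esub> (s b)"
    "\<forall>\<beta> \<in> Binary T. \<forall>b \<in> carrier B. \<forall>a \<in> carrier A.
       sact \<beta> b a \<in> carrier A \<and> i (sact \<beta> b a) = binop E \<beta> (s b) (i a)"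
    using assms(4) unfolding derived_action_def by (elim exE conjE) (rule that; assumption)
  have "gwo T A" "gwo T B" "gwo T E"
    using assms(1-3) *(1) by (auto intro: gwoI)
  with * ** have "split_extension T A B E i p s act sact"
    by (intro split_extension.intro split_extension_axioms.intro gwo_morphismI) simp_all
  then show thesis by (rule that)
qed


section \<open>Internal groupoids out of reflexive graphs\<close>

text \<open>
  For a composition given by \<open>e' - s (p e') + e\<close> all groupoid axioms are formal cancellations,
  so the only thing to be known is that this formula defines a morphism. The inverse of \<open>a\<close> is
  \<open>s (p a) - a + s (t a)\<close>.
\<close>

lemma internal_groupoid_of_reflexive_graph:
  fixes E B :: "('u, 'w, 's) gwo"
  assumes "gwo_morphism T E B p" "gwo_morphism T E B t" "gwo_morphism T B E s"
    and ps [simp]: "\<And>b. b \<in> carrier B \<Longrightarrow> p (s b) = b"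
    and ts [simp]: "\<And>b. b \<in> carrier B \<Longrightarrow> t (s b) = b"
    and comp: "(\<lambda>(e, e'). e' \<otimes>\<^bsub>E\<^esub> inv\<^bsub>E\<^esub> (s (p e')) \<otimes>\<^bsub>E\<^esub> e) \<in> gwo_hom T (gwo_pullback E E t p) E"
  shows "internal_groupoid T
    \<lparr>elts = E, objs = B, d0 = p, d1 = t, eps = s,
     gcomp = \<lambda>e e'. e' \<otimes>\<^bsub>E\<^esub> inv\<^bsub>E\<^esub> (s (p e')) \<otimes>\<^bsub>E\<^esub> e\<rparr>" (is "internal_groupoid T ?H")
proof -
  interpret p: gwo_morphism T E B p by fact
  interpret t: gwo_morphism T E B t by fact
  interpret s: gwo_morphism T B E s by fact
  have "is_groupoid (underlying ?H)"
    unfolding is_groupoid_def underlying_def groupoid.simps igpd.simps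
  proof (intro conjI ballI)
    fix a assume a: "a \<in> carrier E"
    show "\<exists>b \<in> carrier E. p b = t a \<and> t b = p a \<and>
        b \<otimes>\<^bsub>E\<^esub> inv\<^bsub>E\<^esub> (s (p b)) \<otimes>\<^bsub>E\<^esub> a = s (p a) \<and> a \<otimes>\<^bsub>E\<^esub> inv\<^bsub>E\<^esub> (s (p a)) \<otimes>\<^bsub>E\<^esub> b = s (t a)"
      by (rule bexI[of _ "s (p a) \<otimes>\<^bsub>E\<^esub> inv\<^bsub>E\<^esub> a \<otimes>\<^bsub>E\<^esub> s (t a)"])
        (use a in \<open>simp_all add: p.X.m_assoc p.Y.m_assoc\<close>)
  qed (auto simp: p.X.m_assoc p.Y.m_assoc)
  then show ?thesis
    unfolding internal_groupoid_def
    using p.hom t.hom s.hom comp p.X.is_gwo p.Y.is_gwo by simp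
qed


section \<open>The internal groupoid of a crossed module\<close>

text \<open>
  A crossed module together with a split extension that witnesses that its action is derived.
  Condition \<open>CM4\<close> for the opposite operations gives the compatibility of \<open>\<alpha>\<close> with \<open>a \<star> b\<close>.
\<close>

locale crossed_extension = split_extension + \<alpha>: gwo_morphism T A B \<alpha> for \<alpha> +
  assumes CM1: "b \<in> carrier B \<Longrightarrow> a \<in> carrier A \<Longrightarrow> \<alpha> (act b a) = b \<otimes>\<^bsub>B\<^esub> \<alpha> a \<otimes>\<^bsub>B\<^esub> inv\<^bsub>B\<^esub> b"
    and CM2: "a \<in> carrier A \<Longrightarrow> a' \<in> carrier A \<Longrightarrow> act (\<alpha> a) a' = a \<otimes>\<^bsub>A\<^esub> a' \<otimes>\<^bsub>A\<^esub> inv\<^bsub>A\<^esub> a"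
    and CM3: "\<beta> \<in> Binary T \<Longrightarrow> a \<in> carrier A \<Longrightarrow> a' \<in> carrier A \<Longrightarrow>
          sact \<beta> (\<alpha> a) a' = binop A \<beta> a a'"
    and CM4: "\<beta> \<in> Binary T \<Longrightarrow> b \<in> carrier B \<Longrightarrow> a \<in> carrier A \<Longrightarrow>
          \<alpha> (sact \<beta> b a) = binop B \<beta> b (\<alpha> a)"
begin

definition target where "target = glue B \<alpha> (\<lambda>b. b)"

lemma target_i [simp]: "a \<in> carrier A \<Longrightarrow> target (i a) = \<alpha> a"
  unfolding target_def by (simp add: \<alpha>.gwo_morphism_axioms gwo_morphism_id B.gwo_axioms)

lemma target_s [simp]: "b \<in> carrier B \<Longrightarrow> target (s b) = b"
  unfolding target_def by (simp add: \<alpha>.gwo_morphism_axioms gwo_morphism_id B.gwo_axioms)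

sublocale target: gwo_morphism T E B target
  unfolding target_def
  by (rule glue_morphism)
    (simp_all add: \<alpha>.gwo_morphism_axioms gwo_morphism_id B.gwo_axioms CM1 CM4)

lemma target_eq: "e \<in> carrier E \<Longrightarrow> target e = \<alpha> (coord e) \<otimes>\<^bsub>B\<^esub> p e"
  by (simp add: target_def glue_def)

text \<open>
  By (CM2) the elements \<open>e\<close> and \<open>s (target e)\<close> act alike on \<open>A\<close> by conjugation: for \<open>e = i x + s b\<close> the target is
  \<open>\<alpha> x + b\<close>, and \<open>\<alpha> x\<close> acts as conjugation by \<open>x\<close>.
\<close>

lemma conj_target:
  assumes e: "e \<in> carrier E" and a: "a \<in> carrier A"
  shows "s (target e) \<otimes>\<^bsub>E\<^esub> i a \<otimes>\<^bsub>E\<^esub> inv\<^bsub>E\<^esub> (s (target e)) = e \<otimes>\<^bsub>E\<^esub> i a \<otimes>\<^bsub>E\<^esub> inv\<^bsub>E\<^esub> e"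
proof -
  let ?x = "coord e" and ?b = "p e"
  have "s (target e) \<otimes>\<^bsub>E\<^esub> i a \<otimes>\<^bsub>E\<^esub> inv\<^bsub>E\<^esub> (s (target e)) = i (act (\<alpha> ?x) (act ?b a))"
    using e a by (simp add: target_eq E.m_assoc E.inv_mult_group)
  also have "\<dots> = i ?x \<otimes>\<^bsub>E\<^esub> s ?b \<otimes>\<^bsub>E\<^esub> i a \<otimes>\<^bsub>E\<^esub> inv\<^bsub>E\<^esub> (i ?x \<otimes>\<^bsub>E\<^esub> s ?b)"
    using e a by (simp add: CM2 E.m_assoc E.inv_mult_group del: i_coord)
  finally show ?thesis using e by (simp only: decomposition)
qed

text \<open>
  The analogue of \<open>conj_target\<close> for the operations \<open>\<star>\<close>, from (CM3).
\<close>

lemma binop_target: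
  assumes \<beta>: "\<beta> \<in> Binary T" and e: "e \<in> carrier E" and a: "a \<in> carrier A"
  shows "binop E \<beta> (s (target e)) (i a) = binop E \<beta> e (i a)"
proof -
  let ?x = "coord e" and ?b = "p e"
  have "binop E \<beta> (s (target e)) (i a) = i (sact \<beta> (\<alpha> ?x) a) \<otimes>\<^bsub>E\<^esub> binop E \<beta> (s ?b) (i a)"
    using \<beta> e a by (simp add: target_eq)
  also have "\<dots> = binop E \<beta> (i ?x \<otimes>\<^bsub>E\<^esub> s ?b) (i a)"
    using \<beta> e a by (simp add: CM3 del: i_coord)
  finally show ?thesis using e by (simp only: decomposition)
qed

text \<open>
  The pullback of composable pairs is a split extension of \<open>E\<close> (first projection) by \<open>A\<close>, embedded as
  \<open>a \<mapsto> (0, i a)\<close>, with section \<open>e \<mapsto> (e, s (target e))\<close> pairing \<open>e\<close> with the identity at its target.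
  Composition must be \<open>i\<close> on \<open>A\<close> and the identity on \<open>E\<close>, and these glue because \<open>e\<close> and \<open>s (target e)\<close> act alike on \<open>A\<close>.
\<close>

lemma comp_hom:
  "(\<lambda>(e, e'). e' \<otimes>\<^bsub>E\<^esub> inv\<^bsub>E\<^esub> (s (p e')) \<otimes>\<^bsub>E\<^esub> e) \<in> gwo_hom T (gwo_pullback E E target p) E"
proof -
  let ?P = "gwo_pullback E E target p"
  interpret P: gwo T ?P
    using target.gwo_morphism_axioms p.gwo_morphism_axioms by (rule pullback_gwo)
  have \<sigma>: "gwo_morphism T E ?P (\<lambda>e. (e, s (target e)))"
    by (intro gwo_morphismI gwo_homI E.gwo_axioms P.gwo_axioms) simp_all
  then interpret \<sigma>: gwo_morphism T E ?P "\<lambda>e. (e, s (target e))" .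
  interpret P: split_extension T A E ?P "\<lambda>a. (\<one>\<^bsub>E\<^esub>, i a)" fst "\<lambda>e. (e, s (target e))"
    "\<lambda>e. act (target e)" "\<lambda>\<beta> e. sact \<beta> (target e)"
  proof (intro split_extension.intro split_extension_axioms.intro \<sigma> A.gwo_axioms E.gwo_axioms
      P.gwo_axioms gwo_morphismI)
    show "(\<lambda>a. (\<one>\<^bsub>E\<^esub>, i a)) ` carrier A = kernel ?P E fst"
    proof
      show "kernel ?P E fst \<subseteq> (\<lambda>a. (\<one>\<^bsub>E\<^esub>, i a)) ` carrier A"
      proof
        fix x assume "x \<in> kernel ?P E fst"
        then have "fst x = \<one>\<^bsub>E\<^esub>" "snd x \<in> kernel E B p" by (auto simp: kernel_def)
        then show "x \<in> (\<lambda>a. (\<one>\<^bsub>E\<^esub>, i a)) ` carrier A"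
          unfolding i_image[symmetric] by (cases x) auto
      qed
    qed (auto simp: kernel_def)
  next
    fix b a assume *: "b \<in> carrier E" "a \<in> carrier A"
    have "inv\<^bsub>?P\<^esub> (b, s (target b)) = (inv\<^bsub>E\<^esub> b, s (target (inv\<^bsub>E\<^esub> b)))"
      using *(1) by (rule \<sigma>.hom_inv[symmetric])
    with * show "(\<one>\<^bsub>E\<^esub>, i (act (target b) a)) =
       (b, s (target b)) \<otimes>\<^bsub>?P\<^esub> (\<one>\<^bsub>E\<^esub>, i a) \<otimes>\<^bsub>?P\<^esub> inv\<^bsub>?P\<^esub> (b, s (target b))"
      by simp
  qed (auto intro!: gwo_homI inj_onI intro: i_eqD)
  have m: "gwo_morphism T ?P E (P.glue E i (\<lambda>e. e))"
    by (rule P.glue_morphism)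
      (simp_all add: i.gwo_morphism_axioms gwo_morphism_id E.gwo_axioms conj_target binop_target)
  have eq: "P.glue E i (\<lambda>e. e) x = snd x \<otimes>\<^bsub>E\<^esub> inv\<^bsub>E\<^esub> (s (p (snd x))) \<otimes>\<^bsub>E\<^esub> fst x"
    if x: "x \<in> carrier ?P" for x
  proof -
    have "(\<one>\<^bsub>E\<^esub>, i (P.coord x)) = x \<otimes>\<^bsub>?P\<^esub> inv\<^bsub>?P\<^esub> (fst x, s (target (fst x)))"
      using x by (rule P.i_coord)
    also have "inv\<^bsub>?P\<^esub> (fst x, s (target (fst x))) = (inv\<^bsub>E\<^esub> (fst x), s (target (inv\<^bsub>E\<^esub> (fst x))))"
      using x by (intro \<sigma>.hom_inv[symmetric]) simp
    finally show ?thesis using x by (simp add: P.glue_def)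
  qed
  show ?thesis
    by (rule gwo_hom_cong[OF m]) (use eq in \<open>simp add: case_prod_unfold\<close>)
qed

end

lemma crossed_module_extension:
  fixes X :: "('u, 'w, 's) xmod"
  assumes T: "groups_with_operations_theory T" and X: "crossed_module T X"
  obtains E :: "('u, 'w, 's) gwo" and i p s where
    "crossed_extension T (xtop X) (xbase X) E i p s (dot X) (star X) (bd X)"
proof -
  note X = X[unfolded crossed_module_def Let_def]
  have "derived_action T (xtop X) (xbase X) (dot X) (star X)" using X by simp
  then obtain E :: "('u, 'w, 's) gwo" and i p s where
    E: "split_extension T (xtop X) (xbase X) E i p s (dot X) (star X)"
    using T X by (auto elim: derived_action_split_extension[rotated 3])
  have "gwo_morphism T (xtop X) (xbase X) (bd X)"
    using T X by (simp add: gwo_morphismI gwoI)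
  with E have "crossed_extension T (xtop X) (xbase X) E i p s (dot X) (star X) (bd X)"
    by (intro crossed_extension.intro crossed_extension_axioms.intro) (use X in simp_all)
  then show thesis by (rule that)
qed

lemma internal_groupoid_of_crossed_extension:
  fixes E :: "('u, 'w, 's) gwo"
  assumes "crossed_extension T A B E i p s act sact \<alpha>"
  shows "internal_groupoid T
    \<lparr>elts = E, objs = B, d0 = p, d1 = crossed_extension.target A B E i p s \<alpha>, eps = s,
     gcomp = \<lambda>e e'. e' \<otimes>\<^bsub>E\<^esub> inv\<^bsub>E\<^esub> (s (p e')) \<otimes>\<^bsub>E\<^esub> e\<rparr>"
proof -
  interpret crossed_extension T A B E i p s act sact \<alpha> by fact
  show ?thesis
    by (rule internal_groupoid_of_reflexive_graph)
      (simp_all add: p.gwo_morphism_axioms target.gwo_morphism_axioms s.gwo_morphism_axioms comp_hom)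
qed


section \<open>The crossed module of an internal groupoid\<close>

locale internal_gpd =
  fixes T :: "('w, 's) op_theory" and G :: "('u, 'w, 's) igpd"
  assumes ops_theory: "groups_with_operations_theory T"
    and internal: "internal_groupoid T G"
begin

abbreviation Ker :: "'u set" where "Ker \<equiv> kernel (elts G) (objs G) (d0 G)"

sublocale E: gwo T "elts G"
  using internal ops_theory by (simp add: internal_groupoid_def gwoI)
sublocale B: gwo T "objs G"
  using internal ops_theory by (simp add: internal_groupoid_def gwoI)
sublocale d0: gwo_morphism T "elts G" "objs G" "d0 G"
  using internal by (intro gwo_morphismI E.gwo_axioms B.gwo_axioms) (simp add: internal_groupoid_def)
sublocale d1: gwo_morphism T "elts G" "objs G" "d1 G"
  using internal by (intro gwo_morphismI E.gwo_axioms B.gwo_axioms) (simp add: internal_groupoid_def)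
sublocale eps: gwo_morphism T "objs G" "elts G" "eps G"
  using internal by (intro gwo_morphismI E.gwo_axioms B.gwo_axioms) (simp add: internal_groupoid_def)
sublocale A: gwo T "gwo_kernel (elts G) (objs G) (d0 G)"
  using d0.kernel_gwo ops_theory by (rule gwoI[rotated])
sublocale incl: gwo_morphism T "gwo_kernel (elts G) (objs G) (d0 G)" "elts G" "\<lambda>a. a"
  by (intro gwo_morphismI A.gwo_axioms E.gwo_axioms gwo_homI) (simp_all add: kernel_def)
\<comment> \<open>As a rewrite rule this would reduce membership in the ambient carrier to membership in the kernel,
  which unfolds to membership in the ambient carrier again; \<open>ext.p_i\<close> below is similar.\<close>
declare incl.hom_closed [simp del]

lemma underlying_groupoid: "is_groupoid (underlying G)"
  using internal by (simp add: internal_groupoid_def)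

lemma d_eps [simp]: "x \<in> carrier (objs G) \<Longrightarrow> d0 G (eps G x) = x"
  "x \<in> carrier (objs G) \<Longrightarrow> d1 G (eps G x) = x"
  using underlying_groupoid by (simp_all add: is_groupoid_def underlying_def)

lemma gcomp_eps [simp]:
  "a \<in> carrier (elts G) \<Longrightarrow> gcomp G (eps G (d0 G a)) a = a"
  "a \<in> carrier (elts G) \<Longrightarrow> gcomp G a (eps G (d1 G a)) = a"
  using underlying_groupoid by (simp_all add: is_groupoid_def underlying_def)

lemma KerD: "a \<in> Ker \<Longrightarrow> a \<in> carrier (elts G)" "a \<in> Ker \<Longrightarrow> d0 G a = \<one>\<^bsub>objs G\<^esub>"
  by (simp_all add: kernel_def)

lemma gcomp_one [simp]:
  "a \<in> Ker \<Longrightarrow> gcomp G \<one>\<^bsub>elts G\<^esub> a = a"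
  "a \<in> carrier (elts G) \<Longrightarrow> d1 G a = \<one>\<^bsub>objs G\<^esub> \<Longrightarrow> gcomp G a \<one>\<^bsub>elts G\<^esub> = a"
  using gcomp_eps(1)[of a] gcomp_eps(2)[of a] by (auto simp: kernel_def)

lemma interchange:
  assumes "a \<in> carrier (elts G)" "b \<in> carrier (elts G)" "d1 G a = d0 G b"
    and "a' \<in> carrier (elts G)" "b' \<in> carrier (elts G)" "d1 G a' = d0 G b'"
  shows "gcomp G (a \<otimes>\<^bsub>elts G\<^esub> a') (b \<otimes>\<^bsub>elts G\<^esub> b') = gcomp G a b \<otimes>\<^bsub>elts G\<^esub> gcomp G a' b'"
    and "\<beta> \<in> Binary T \<Longrightarrow> gcomp G (binop (elts G) \<beta> a a') (binop (elts G) \<beta> b b') =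
           binop (elts G) \<beta> (gcomp G a b) (gcomp G a' b')"
proof -
  have P: "(a, b) \<in> carrier (gwo_pullback (elts G) (elts G) (d1 G) (d0 G))"
    "(a', b') \<in> carrier (gwo_pullback (elts G) (elts G) (d1 G) (d0 G))"
    using assms by simp_all
  interpret c: gwo_morphism T "gwo_pullback (elts G) (elts G) (d1 G) (d0 G)" "elts G"
    "\<lambda>(a, b). gcomp G a b"
    using internal pullback_gwo[OF d1.gwo_morphism_axioms d0.gwo_morphism_axioms]
    by (intro gwo_morphismI E.gwo_axioms) (simp_all add: internal_groupoid_def)
  show "gcomp G (a \<otimes>\<^bsub>elts G\<^esub> a') (b \<otimes>\<^bsub>elts G\<^esub> b') = gcomp G a b \<otimes>\<^bsub>elts G\<^esub> gcomp G a' b'"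
    using c.hom_mult[OF P] by simp
  show "gcomp G (binop (elts G) \<beta> a a') (binop (elts G) \<beta> b b') =
           binop (elts G) \<beta> (gcomp G a b) (gcomp G a' b')" if "\<beta> \<in> Binary T"
    using c.hom_binop[OF that P] by simp
qed

text \<open>
  Composition is forced by the group structure. With \<open>x = d0 b\<close>, the pair \<open>(a, b)\<close> is the sum of
  \<open>(0, b - \<epsilon> x)\<close> and \<open>(a, \<epsilon> x)\<close>, and also of \<open>(a - \<epsilon> x, 0)\<close> and \<open>(\<epsilon> x, b)\<close>; in each of these four pairs one
  entry is an identity of the groupoid. The first formula shows that any map compatible with
  \<open>d0\<close>, \<open>d1\<close> and \<open>\<epsilon>\<close> preserves composition; comparing the two yields (CM2).
\<close>

lemma gcomp_eq:
  assumes "a \<in> carrier (elts G)" "b \<in> carrier (elts G)" "d1 G a = d0 G b"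
  shows "gcomp G a b = b \<otimes>\<^bsub>elts G\<^esub> inv\<^bsub>elts G\<^esub> (eps G (d0 G b)) \<otimes>\<^bsub>elts G\<^esub> a"
    and "gcomp G a b = a \<otimes>\<^bsub>elts G\<^esub> inv\<^bsub>elts G\<^esub> (eps G (d0 G b)) \<otimes>\<^bsub>elts G\<^esub> b"
proof -
  let ?e = "eps G (d0 G b)"
  have a: "gcomp G a ?e = a" using gcomp_eps(2)[of a] assms by simp
  let ?c = "b \<otimes>\<^bsub>elts G\<^esub> inv\<^bsub>elts G\<^esub> ?e"
  have "gcomp G a b = gcomp G (\<one>\<^bsub>elts G\<^esub> \<otimes>\<^bsub>elts G\<^esub> a) (?c \<otimes>\<^bsub>elts G\<^esub> ?e)"
    using assms by (simp add: E.m_assoc)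
  also have "\<dots> = gcomp G \<one>\<^bsub>elts G\<^esub> ?c \<otimes>\<^bsub>elts G\<^esub> gcomp G a ?e"
    using assms by (intro interchange) simp_all
  finally show "gcomp G a b = ?c \<otimes>\<^bsub>elts G\<^esub> a"
    using assms a by (simp add: kernel_def)
  let ?c = "a \<otimes>\<^bsub>elts G\<^esub> inv\<^bsub>elts G\<^esub> ?e"
  have "gcomp G a b = gcomp G (?c \<otimes>\<^bsub>elts G\<^esub> ?e) (\<one>\<^bsub>elts G\<^esub> \<otimes>\<^bsub>elts G\<^esub> b)"
    using assms by (simp add: E.m_assoc)
  also have "\<dots> = gcomp G ?c \<one>\<^bsub>elts G\<^esub> \<otimes>\<^bsub>elts G\<^esub> gcomp G ?e b"
    using assms by (intro interchange) simp_all
  finally show "gcomp G a b = ?c \<otimes>\<^bsub>elts G\<^esub> b"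
    using assms by simp
qed

text \<open>
  Condition (CM2): compare the two formulas for \<open>a \<circ> (\<epsilon> (d1 a) + c)\<close>.
\<close>

lemma peiffer_conj:
  assumes a: "a \<in> Ker" and c: "c \<in> Ker"
  shows "eps G (d1 G a) \<otimes>\<^bsub>elts G\<^esub> c \<otimes>\<^bsub>elts G\<^esub> inv\<^bsub>elts G\<^esub> (eps G (d1 G a)) =
    a \<otimes>\<^bsub>elts G\<^esub> c \<otimes>\<^bsub>elts G\<^esub> inv\<^bsub>elts G\<^esub> a"
proof -
  let ?e = "eps G (d1 G a)"
  note [simp] = KerD[OF a] KerD[OF c]
  let ?b = "?e \<otimes>\<^bsub>elts G\<^esub> c"
  have "?b \<otimes>\<^bsub>elts G\<^esub> inv\<^bsub>elts G\<^esub> ?e \<otimes>\<^bsub>elts G\<^esub> a = a \<otimes>\<^bsub>elts G\<^esub> inv\<^bsub>elts G\<^esub> ?e \<otimes>\<^bsub>elts G\<^esub> ?b"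
    using gcomp_eq[of a ?b] by simp
  also have "\<dots> = a \<otimes>\<^bsub>elts G\<^esub> c"
    by (simp add: E.m_assoc)
  finally show ?thesis
    by (simp add: E.inv_solve_right)
qed

text \<open>
  Condition (CM3): apply the interchange law to \<open>(a, \<epsilon> (d1 a)) \<star> (0, c)\<close> and use \<open>a \<star> 0 = 0\<close>.
\<close>

lemma peiffer_binop:
  assumes \<beta>: "\<beta> \<in> Binary T" and a: "a \<in> Ker" and c: "c \<in> Ker"
  shows "binop (elts G) \<beta> (eps G (d1 G a)) c = binop (elts G) \<beta> a c"
proof -
  let ?e = "eps G (d1 G a)"
  note [simp] = KerD[OF a] KerD[OF c]
  have "gcomp G (binop (elts G) \<beta> a \<one>\<^bsub>elts G\<^esub>) (binop (elts G) \<beta> ?e c) =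
      binop (elts G) \<beta> (gcomp G a ?e) (gcomp G \<one>\<^bsub>elts G\<^esub> c)"
    using \<beta> by (intro interchange) simp_all
  moreover have "binop (elts G) \<beta> ?e c \<in> Ker"
    using \<beta> by (simp add: kernel_def)
  ultimately show ?thesis
    using \<beta> c by simp
qed

sublocale ext: split_extension T "gwo_kernel (elts G) (objs G) (d0 G)" "objs G" "elts G"
  "\<lambda>a. a" "d0 G" "eps G" "dot (xmod_of G)" "star (xmod_of G)"
  by (unfold_locales) (auto simp: xmod_of_def kernel_def)
declare ext.p_i [simp del]

lemma crossed_module: "crossed_module T (xmod_of G)"
proof -
  let ?A = "gwo_kernel (elts G) (objs G) (d0 G)"
  have "derived_action T ?A (objs G) (dot (xmod_of G)) (star (xmod_of G))"
    unfolding derived_action_def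
  proof (intro exI conjI ballI)
    show "d0 G ` carrier (elts G) = carrier (objs G)"
    proof
      show "carrier (objs G) \<subseteq> d0 G ` carrier (elts G)"
      proof
        fix x assume "x \<in> carrier (objs G)"
        then show "x \<in> d0 G ` carrier (elts G)"
          by (intro image_eqI[of _ _ "eps G x"]) simp_all
      qed
    qed auto
  qed (use ext.i_inj ext.i_image ext.act_closed ext.sact_closed in
      \<open>auto simp: E.is_gwo incl.hom d0.hom eps.hom\<close>)
  moreover have "d1 G \<in> gwo_hom T ?A (objs G)"
    by (rule gwo_homI) (auto simp: kernel_def)
  moreover have "inv\<^bsub>?A\<^esub> a = inv\<^bsub>elts G\<^esub> a" if "a \<in> Ker" for a
    using incl.hom_inv[of a] that by simp
  ultimately show ?thesis
    unfolding crossed_module_def Let_def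
    using A.is_gwo B.is_gwo peiffer_conj peiffer_binop
    by (simp add: xmod_of_def KerD)
qed

end


section \<open>Morphisms of crossed modules\<close>

lemma xmod_hom_iff:
  "f \<in> xmod_hom T X Y \<longleftrightarrow>
     fst f \<in> gwo_hom T (xtop X) (xtop Y) \<and> fst f \<in> extensional (carrier (xtop X)) \<and>
     snd f \<in> gwo_hom T (xbase X) (xbase Y) \<and> snd f \<in> extensional (carrier (xbase X)) \<and>
     (\<forall>a \<in> carrier (xtop X). snd f (bd X a) = bd Y (fst f a)) \<and>
     (\<forall>b \<in> carrier (xbase X). \<forall>a \<in> carrier (xtop X).
        fst f (dot X b a) = dot Y (snd f b) (fst f a)) \<and>
     (\<forall>\<beta> \<in> Binary T. \<forall>b \<in> carrier (xbase X). \<forall>a \<in> carrier (xtop X).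
        fst f (star X \<beta> b a) = star Y \<beta> (snd f b) (fst f a))"
  by (cases f) (simp add: xmod_hom_def)

lemma gwo_hom_funcset: "f \<in> gwo_hom T X Y \<Longrightarrow> f \<in> carrier X \<rightarrow> carrier Y"
  by (simp add: gwo_hom_def hom_def)

lemma xmod_hom_funcset:
  assumes "f \<in> xmod_hom T X Y"
  shows "fst f \<in> carrier (xtop X) \<rightarrow> carrier (xtop Y)" "snd f \<in> carrier (xbase X) \<rightarrow> carrier (xbase Y)"
    "fst f \<in> extensional (carrier (xtop X))" "snd f \<in> extensional (carrier (xbase X))"
  using assms by (auto simp: xmod_hom_iff dest: gwo_hom_funcset)

lemma gwo_hom_compose:
  assumes "gwo T X" "gwo T Y" "gwo T Z" "f \<in> gwo_hom T X Y" "g \<in> gwo_hom T Y Z"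
  shows "compose (carrier X) g f \<in> gwo_hom T X Z"
proof (rule gwo_hom_cong)
  show "gwo_morphism T X Z (\<lambda>x. g (f x))"
    using assms by (intro gwo_morphism_comp[of T X Y f Z g] gwo_morphismI)
qed (simp add: compose_eq)

locale xmodule =
  fixes T :: "('w, 's) op_theory" and X :: "('u, 'w, 's) xmod"
  assumes ops_theory: "groups_with_operations_theory T"
    and crossed: "crossed_module T X"
begin

lemma top_gwo: "gwo T (xtop X)" and base_gwo: "gwo T (xbase X)"
  using ops_theory crossed by (simp_all add: crossed_module_def Let_def gwoI)

lemma action_closed:
  assumes "a \<in> carrier (xtop X)"
  shows "bd X a \<in> carrier (xbase X)"
    and "b \<in> carrier (xbase X) \<Longrightarrow> dot X b a \<in> carrier (xtop X)"
    and "\<beta> \<in> Binary T \<Longrightarrow> b \<in> carrier (xbase X) \<Longrightarrow> star X \<beta> b a \<in> carrier (xtop X)"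
proof -
  obtain E :: "('u, 'w, 's) gwo" and i p s where
    "crossed_extension T (xtop X) (xbase X) E i p s (dot X) (star X) (bd X)"
    using crossed_module_extension[OF ops_theory crossed] by blast
  then interpret crossed_extension T "xtop X" "xbase X" E i p s "dot X" "star X" "bd X" .
  show "bd X a \<in> carrier (xbase X)"
    and "b \<in> carrier (xbase X) \<Longrightarrow> dot X b a \<in> carrier (xtop X)"
    and "\<beta> \<in> Binary T \<Longrightarrow> b \<in> carrier (xbase X) \<Longrightarrow> star X \<beta> b a \<in> carrier (xtop X)"
    using assms by simp_all
qed

end

lemma xmod_compose_hom:
  assumes "xmodule T X" "xmodule T Y" "xmodule T Z"
    and f: "f \<in> xmod_hom T X Y" and g: "g \<in> xmod_hom T Y Z"
  shows "xmod_compose X g f \<in> xmod_hom T X Z"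
proof -
  interpret X: xmodule T X by fact
  interpret Y: xmodule T Y by fact
  interpret Z: xmodule T Z by fact
  have "compose (carrier (xtop X)) (fst g) (fst f) \<in> gwo_hom T (xtop X) (xtop Z)"
    using f g by (intro gwo_hom_compose[OF X.top_gwo Y.top_gwo Z.top_gwo]) (simp_all add: xmod_hom_iff)
  moreover have "compose (carrier (xbase X)) (snd g) (snd f) \<in> gwo_hom T (xbase X) (xbase Z)"
    using f g by (intro gwo_hom_compose[OF X.base_gwo Y.base_gwo Z.base_gwo]) (simp_all add: xmod_hom_iff)
  moreover have "fst f a \<in> carrier (xtop Y)" if "a \<in> carrier (xtop X)" for a
    using xmod_hom_funcset(1)[OF f] that by blast
  moreover have "snd f a \<in> carrier (xbase Y)" if "a \<in> carrier (xbase X)" for a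
    using xmod_hom_funcset(2)[OF f] that by blast
  ultimately show ?thesis
    using f g by (simp add: xmod_hom_iff xmod_compose_def compose_eq X.action_closed)
qed

lemma xmod_id_hom: "xmodule T X \<Longrightarrow> xmod_id X \<in> xmod_hom T X X"
proof -
  assume "xmodule T X"
  then interpret xmodule T X .
  have "(\<lambda>a \<in> carrier (xtop X). a) \<in> gwo_hom T (xtop X) (xtop X)"
    "(\<lambda>b \<in> carrier (xbase X). b) \<in> gwo_hom T (xbase X) (xbase X)"
    by (auto intro: gwo_hom_cong[OF gwo_morphism_id] top_gwo base_gwo)
  then show ?thesis
    by (simp add: xmod_hom_iff xmod_id_def action_closed)
qed

lemma xmod_compose_assoc:
  "f \<in> xmod_hom T X Y \<Longrightarrow>
     xmod_compose X h (xmod_compose X g f) = xmod_compose X (xmod_compose Y h g) f"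
  by (simp add: xmod_compose_def compose_assoc xmod_hom_funcset)

lemma xmod_compose_id:
  assumes "f \<in> xmod_hom T X Y"
  shows "xmod_compose X f (xmod_id X) = f" "xmod_compose X (xmod_id Y) f = f"
  using xmod_hom_funcset[OF assms] by (simp_all add: xmod_compose_def xmod_id_def compose_Id Id_compose)

lemma xmod_inverse:
  assumes "xmodule T X" "xmodule T Y" and f: "f \<in> xmod_hom T X Y"
    and bij: "bij_betw (fst f) (carrier (xtop X)) (carrier (xtop Y))"
      "bij_betw (snd f) (carrier (xbase X)) (carrier (xbase Y))"
  obtains g where "g \<in> xmod_hom T Y X" "xmod_compose X g f = xmod_id X"
    "xmod_compose Y f g = xmod_id Y" "bij_betw (fst g) (carrier (xtop Y)) (carrier (xtop X))"
proof -
  interpret X: xmodule T X by fact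
  interpret Y: xmodule T Y by fact
  define g1 where "g1 = restrict (inv_into (carrier (xtop X)) (fst f)) (carrier (xtop Y))"
  define g0 where "g0 = restrict (inv_into (carrier (xbase X)) (snd f)) (carrier (xbase Y))"
  have g1: "bij_betw g1 (carrier (xtop Y)) (carrier (xtop X))"
    unfolding g1_def using bij_betw_inv_into[OF bij(1)] by simp
  have fg1: "g1 a \<in> carrier (xtop X)" "fst f (g1 a) = a" if "a \<in> carrier (xtop Y)" for a
    using that bij_betw_inv_into_right[OF bij(1)] bij_betw_apply[OF g1] by (auto simp: g1_def)
  have fg0: "g0 b \<in> carrier (xbase X)" "snd f (g0 b) = b" if "b \<in> carrier (xbase Y)" for b
    using that bij_betw_inv_into_right[OF bij(2)] bij_betw_apply[OF bij_betw_inv_into[OF bij(2)]]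
    by (auto simp: g0_def)
  have gf1: "g1 a' = a" if "a \<in> carrier (xtop X)" "fst f a = a'" for a a'
    using that bij_betw_inv_into_left[OF bij(1)] bij_betw_apply[OF bij(1)] by (auto simp: g1_def)
  have gf0: "g0 b' = b" if "b \<in> carrier (xbase X)" "snd f b = b'" for b b'
    using that bij_betw_inv_into_left[OF bij(2)] bij_betw_apply[OF bij(2)] by (auto simp: g0_def)
  note hom = f[unfolded xmod_hom_iff]
  have homs: "fst f \<in> gwo_hom T (xtop X) (xtop Y)" "snd f \<in> gwo_hom T (xbase X) (xbase Y)"
    using hom by simp_all
  have "g1 \<in> gwo_hom T (xtop Y) (xtop X)"
    by (rule gwo_hom_cong[OF gwo_morphismI[OF Y.top_gwo X.top_gwo
        gwo_isoI(2)[OF X.top_gwo Y.top_gwo homs(1) bij(1)]]]) (simp add: g1_def)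
  moreover have "g0 \<in> gwo_hom T (xbase Y) (xbase X)"
    by (rule gwo_hom_cong[OF gwo_morphismI[OF Y.base_gwo X.base_gwo
        gwo_isoI(2)[OF X.base_gwo Y.base_gwo homs(2) bij(2)]]]) (simp add: g0_def)
  moreover have "g0 (bd Y a) = bd X (g1 a)" if "a \<in> carrier (xtop Y)" for a
    using fg1[OF that] hom by (intro gf0) (simp_all add: X.action_closed)
  moreover have "g1 (dot Y b a) = dot X (g0 b) (g1 a)"
    if "a \<in> carrier (xtop Y)" "b \<in> carrier (xbase Y)" for a b
    using fg1[OF that(1)] fg0[OF that(2)] hom by (intro gf1) (simp_all add: X.action_closed)
  moreover have "g1 (star Y \<beta> b a) = star X \<beta> (g0 b) (g1 a)"
    if "\<beta> \<in> Binary T" "a \<in> carrier (xtop Y)" "b \<in> carrier (xbase Y)" for \<beta> a b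
    using that(1) fg1[OF that(2)] fg0[OF that(3)] hom by (intro gf1) (simp_all add: X.action_closed)
  moreover have "g1 \<in> extensional (carrier (xtop Y))" "g0 \<in> extensional (carrier (xbase Y))"
    by (simp_all add: g1_def g0_def)
  ultimately have "(g1, g0) \<in> xmod_hom T Y X"
    by (simp add: xmod_hom_iff)
  moreover have "xmod_compose X (g1, g0) f = xmod_id X"
    by (auto simp: xmod_compose_def xmod_id_def compose_def restrict_def fun_eq_iff gf1 gf0)
  moreover have "xmod_compose Y f (g1, g0) = xmod_id Y"
    by (auto simp: xmod_compose_def xmod_id_def compose_def restrict_def fun_eq_iff fg1 fg0)
  ultimately show thesis
    using g1 by (intro that[of "(g1, g0)"]) simp_all
qed


section \<open>Morphisms of internal groupoids\<close>

lemma igpd_hom_iff: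
  "f \<in> igpd_hom T H K \<longleftrightarrow>
     groupoid_morphism (underlying H) (underlying K) f \<and>
     fst f \<in> gwo_hom T (elts H) (elts K) \<and> fst f \<in> extensional (carrier (elts H)) \<and>
     snd f \<in> gwo_hom T (objs H) (objs K) \<and> snd f \<in> extensional (carrier (objs H))"
  by (cases f) (simp add: igpd_hom_def)

lemma xmod_of_simps [simp]:
  "xtop (xmod_of H) = gwo_kernel (elts H) (objs H) (d0 H)" "xbase (xmod_of H) = objs H"
  "bd (xmod_of H) = d1 H"
  by (simp_all add: xmod_of_def)

lemma igpd_hom_funcset:
  assumes "f \<in> igpd_hom T H K"
  shows "fst f \<in> carrier (elts H) \<rightarrow> carrier (elts K)" "snd f \<in> carrier (objs H) \<rightarrow> carrier (objs K)"
    "fst f \<in> extensional (carrier (elts H))" "snd f \<in> extensional (carrier (objs H))"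
  using assms by (auto simp: igpd_hom_iff dest: gwo_hom_funcset)

text \<open>
  Preservation of composition is automatic by \<open>gcomp_eq\<close>.
\<close>

lemma igpd_homI:
  assumes H: "internal_gpd T H" and K: "internal_gpd T K"
    and "f1 \<in> gwo_hom T (elts H) (elts K)" "f1 \<in> extensional (carrier (elts H))"
    and "f0 \<in> gwo_hom T (objs H) (objs K)" "f0 \<in> extensional (carrier (objs H))"
    and d: "\<And>a. a \<in> carrier (elts H) \<Longrightarrow> d0 K (f1 a) = f0 (d0 H a)"
      "\<And>a. a \<in> carrier (elts H) \<Longrightarrow> d1 K (f1 a) = f0 (d1 H a)"
    and e: "\<And>x. x \<in> carrier (objs H) \<Longrightarrow> f1 (eps H x) = eps K (f0 x)"
  shows "(f1, f0) \<in> igpd_hom T H K"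
proof -
  interpret H: internal_gpd T H by fact
  interpret K: internal_gpd T K by fact
  interpret f1: gwo_morphism T "elts H" "elts K" f1
    by (intro gwo_morphismI H.E.gwo_axioms K.E.gwo_axioms assms)
  interpret f0: gwo_morphism T "objs H" "objs K" f0
    by (intro gwo_morphismI H.B.gwo_axioms K.B.gwo_axioms assms)
  have "f1 (gcomp H a b) = gcomp K (f1 a) (f1 b)"
    if "a \<in> carrier (elts H)" "b \<in> carrier (elts H)" "d1 H a = d0 H b" for a b
    using that by (simp add: H.gcomp_eq(1) K.gcomp_eq(1) d e)
  then have "groupoid_morphism (underlying H) (underlying K) (f1, f0)"
    by (simp add: groupoid_morphism_def underlying_def d e)
  then show ?thesis
    using assms by (simp add: igpd_hom_iff)
qed

locale internal_gpd_morphism = H: internal_gpd T H + K: internal_gpd T K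
  for T :: "('w, 's) op_theory" and H :: "('u, 'w, 's) igpd" and K :: "('u, 'w, 's) igpd" +
  fixes f
  assumes f: "f \<in> igpd_hom T H K"
begin

sublocale f1: gwo_morphism T "elts H" "elts K" "fst f"
  using f by (intro gwo_morphismI H.E.gwo_axioms K.E.gwo_axioms) (simp add: igpd_hom_iff)
sublocale f0: gwo_morphism T "objs H" "objs K" "snd f"
  using f by (intro gwo_morphismI H.B.gwo_axioms K.B.gwo_axioms) (simp add: igpd_hom_iff)

lemma hom_d [simp]:
  "a \<in> carrier (elts H) \<Longrightarrow> d0 K (fst f a) = snd f (d0 H a)"
  "a \<in> carrier (elts H) \<Longrightarrow> d1 K (fst f a) = snd f (d1 H a)"
  using f by (simp_all add: igpd_hom_iff groupoid_morphism_def underlying_def)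

lemma hom_eps [simp]: "x \<in> carrier (objs H) \<Longrightarrow> fst f (eps H x) = eps K (snd f x)"
  using f by (simp add: igpd_hom_iff groupoid_morphism_def underlying_def)

lemma hom_Ker: "a \<in> H.Ker \<Longrightarrow> fst f a \<in> K.Ker"
  by (simp add: kernel_def)

text \<open>
  Coverings need only be tested on the star of \<open>0\<close>, because subtracting \<open>\<epsilon> x\<close> translates the star of \<open>x\<close>
  into \<open>Ker d0\<close>, compatibly with morphisms.
\<close>

lemma covering_iff:
  "covering_morphism (underlying H) (underlying K) f \<longleftrightarrow> bij_betw (fst f) H.Ker K.Ker"
proof
  have St_one: "St (underlying H) \<one>\<^bsub>objs H\<^esub> = H.Ker" "St (underlying K) \<one>\<^bsub>objs K\<^esub> = K.Ker"
    by (auto simp: St_def underlying_def kernel_def)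
  assume cov: "covering_morphism (underlying H) (underlying K) f"
  have "\<one>\<^bsub>objs H\<^esub> \<in> Ob (underlying H)" by (simp add: underlying_def)
  with cov have "bij_betw (fst f) (St (underlying H) \<one>\<^bsub>objs H\<^esub>) (St (underlying K) (snd f \<one>\<^bsub>objs H\<^esub>))"
    unfolding covering_morphism_def by blast
  then show "bij_betw (fst f) H.Ker K.Ker" by (simp add: St_one)
next
  assume bij: "bij_betw (fst f) H.Ker K.Ker"
  have "bij_betw (fst f) (St (underlying H) x) (St (underlying K) (snd f x))"
    if x: "x \<in> carrier (objs H)" for x
  proof (rule bij_betw_imageI)
    show "inj_on (fst f) (St (underlying H) x)"
    proof (rule inj_onI)
      fix a b assume ab: "a \<in> St (underlying H) x" "b \<in> St (underlying H) x" "fst f a = fst f b"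
      then have *: "a \<in> carrier (elts H)" "b \<in> carrier (elts H)" "d0 H a = x" "d0 H b = x"
        by (auto simp: St_def underlying_def)
      have "a \<otimes>\<^bsub>elts H\<^esub> inv\<^bsub>elts H\<^esub> (eps H x) = b \<otimes>\<^bsub>elts H\<^esub> inv\<^bsub>elts H\<^esub> (eps H x)"
        using bij_betw_imp_inj_on[OF bij]
        by (rule inj_onD) (use * x ab(3) in \<open>simp_all add: kernel_def\<close>)
      then show "a = b" using * x by simp
    qed
    show "fst f ` St (underlying H) x = St (underlying K) (snd f x)"
    proof
      show "fst f ` St (underlying H) x \<subseteq> St (underlying K) (snd f x)"
        by (auto simp: St_def underlying_def)
      show "St (underlying K) (snd f x) \<subseteq> fst f ` St (underlying H) x"
      proof
        fix c assume "c \<in> St (underlying K) (snd f x)"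
        then have c: "c \<in> carrier (elts K)" "d0 K c = snd f x"
          by (auto simp: St_def underlying_def)
        then have "c \<otimes>\<^bsub>elts K\<^esub> inv\<^bsub>elts K\<^esub> (eps K (snd f x)) \<in> fst f ` H.Ker"
          unfolding bij_betw_imp_surj_on[OF bij] using x by (simp add: kernel_def)
        then obtain k where k: "k \<in> H.Ker"
          "c \<otimes>\<^bsub>elts K\<^esub> inv\<^bsub>elts K\<^esub> (eps K (snd f x)) = fst f k"
          by blast
        have "fst f (k \<otimes>\<^bsub>elts H\<^esub> eps H x) = c"
          using k(1) x c by (simp add: H.KerD K.E.m_assoc flip: k(2))
        then show "c \<in> fst f ` St (underlying H) x"
          using k(1) x by (intro image_eqI[of _ _ "k \<otimes>\<^bsub>elts H\<^esub> eps H x"])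
            (simp_all add: St_def underlying_def H.KerD)
      qed
    qed
  qed
  moreover have "groupoid_morphism (underlying H) (underlying K) f"
    using f by (simp add: igpd_hom_iff)
  ultimately show "covering_morphism (underlying H) (underlying K) f"
    by (simp add: covering_morphism_def underlying_def)
qed

end

lemma igpd_compose_hom:
  assumes "internal_gpd_morphism T H K f" "internal_gpd_morphism T K L g"
  shows "igpd_compose H g f \<in> igpd_hom T H L"
proof -
  interpret f: internal_gpd_morphism T H K f by fact
  interpret g: internal_gpd_morphism T K L g by fact
  show ?thesis
    unfolding igpd_compose_def
    by (rule igpd_homI)
      (simp_all add: f.H.internal_gpd_axioms g.K.internal_gpd_axioms compose_eq
        gwo_hom_compose[OF f.H.E.gwo_axioms f.K.E.gwo_axioms g.K.E.gwo_axioms f.f1.hom g.f1.hom]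
        gwo_hom_compose[OF f.H.B.gwo_axioms f.K.B.gwo_axioms g.K.B.gwo_axioms f.f0.hom g.f0.hom])
qed

lemma igpd_id_hom: "internal_gpd T H \<Longrightarrow> igpd_id H \<in> igpd_hom T H H"
proof -
  assume "internal_gpd T H"
  then interpret internal_gpd T H .
  have "(\<lambda>a \<in> carrier (elts H). a) \<in> gwo_hom T (elts H) (elts H)"
    "(\<lambda>b \<in> carrier (objs H). b) \<in> gwo_hom T (objs H) (objs H)"
    by (auto intro: gwo_hom_cong[OF gwo_morphism_id] E.gwo_axioms B.gwo_axioms)
  then show ?thesis
    unfolding igpd_id_def by (intro igpd_homI internal_gpd_axioms) simp_all
qed

lemma igpd_compose_assoc:
  "f \<in> igpd_hom T H K \<Longrightarrow>
     igpd_compose H h (igpd_compose H g f) = igpd_compose H (igpd_compose K h g) f"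
  by (simp add: igpd_compose_def compose_assoc igpd_hom_funcset)

lemma igpd_compose_id:
  assumes "f \<in> igpd_hom T H K"
  shows "igpd_compose H f (igpd_id H) = f" "igpd_compose H (igpd_id K) f = f"
  using igpd_hom_funcset[OF assms] by (simp_all add: igpd_compose_def igpd_id_def compose_Id Id_compose)


section \<open>Restriction to the kernel\<close>

definition restr :: "('u, 'w, 's) igpd \<Rightarrow> ('u \<Rightarrow> 'u) \<times> ('u \<Rightarrow> 'u) \<Rightarrow> ('u \<Rightarrow> 'u) \<times> ('u \<Rightarrow> 'u)" where
  "restr H f = (restrict (fst f) (kernel (elts H) (objs H) (d0 H)), snd f)"

lemma internal_gpd_xmodule: "internal_gpd T H \<Longrightarrow> xmodule T (xmod_of H)"
  by (simp add: xmodule_def internal_gpd.crossed_module internal_gpd.ops_theory)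

context internal_gpd_morphism
begin

lemma restr_hom: "restr H f \<in> xmod_hom T (xmod_of H) (xmod_of K)"
proof -
  have "fst (restr H f) \<in> gwo_hom T (gwo_kernel (elts H) (objs H) (d0 H))
      (gwo_kernel (elts K) (objs K) (d0 K))"
  proof (rule gwo_homI)
    fix a b assume "a \<in> carrier (gwo_kernel (elts H) (objs H) (d0 H))"
      "b \<in> carrier (gwo_kernel (elts H) (objs H) (d0 H))"
    then show "fst (restr H f) (a \<otimes>\<^bsub>gwo_kernel (elts H) (objs H) (d0 H)\<^esub> b) =
        fst (restr H f) a \<otimes>\<^bsub>gwo_kernel (elts K) (objs K) (d0 K)\<^esub> fst (restr H f) b"
      using H.A.m_closed[of a b] by (simp add: restr_def H.KerD)
  next
    fix \<omega> a assume "\<omega> \<in> Unary T" "a \<in> carrier (gwo_kernel (elts H) (objs H) (d0 H))"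
    then show "fst (restr H f) (unop (gwo_kernel (elts H) (objs H) (d0 H)) \<omega> a) =
        unop (gwo_kernel (elts K) (objs K) (d0 K)) \<omega> (fst (restr H f) a)"
      using H.A.unop_closed[of \<omega> a] by (simp add: restr_def H.KerD)
  next
    fix \<beta> a b assume "\<beta> \<in> Binary T" "a \<in> carrier (gwo_kernel (elts H) (objs H) (d0 H))"
      "b \<in> carrier (gwo_kernel (elts H) (objs H) (d0 H))"
    then show "fst (restr H f) (binop (gwo_kernel (elts H) (objs H) (d0 H)) \<beta> a b) =
        binop (gwo_kernel (elts K) (objs K) (d0 K)) \<beta> (fst (restr H f) a) (fst (restr H f) b)"
      using H.A.binop_closed[of \<beta> a b] by (simp add: restr_def H.KerD)
  qed (simp add: restr_def hom_Ker)
  moreover have "fst (restr H f) (dot (xmod_of H) b a) = dot (xmod_of K) (snd f b) (fst (restr H f) a)"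
    if "b \<in> carrier (objs H)" "a \<in> H.Ker" for a b
    using that H.ext.act_closed[of b a] by (simp add: restr_def xmod_of_def H.KerD)
  moreover have "fst (restr H f) (star (xmod_of H) \<beta> b a) = star (xmod_of K) \<beta> (snd f b) (fst (restr H f) a)"
    if "\<beta> \<in> Binary T" "b \<in> carrier (objs H)" "a \<in> H.Ker" for \<beta> a b
    using that H.ext.sact_closed[of \<beta> b a] by (simp add: restr_def xmod_of_def H.KerD)
  moreover have "snd f \<in> extensional (carrier (objs H))"
    using f by (simp add: igpd_hom_iff)
  ultimately show ?thesis
    using f0.hom by (simp add: xmod_hom_iff) (simp add: restr_def H.KerD)
qed

lemma restr_compose: "restr H (igpd_compose H g f) = xmod_compose (xmod_of H) (restr K g) (restr H f)"
  by (auto simp: restr_def igpd_compose_def xmod_compose_def compose_def restrict_def fun_eq_iff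
      H.KerD hom_Ker)

end

lemma internal_gpd_morphismI:
  "internal_gpd T H \<Longrightarrow> internal_gpd T K \<Longrightarrow> f \<in> igpd_hom T H K \<Longrightarrow> internal_gpd_morphism T H K f"
  by (simp add: internal_gpd_morphism_def internal_gpd_morphism_axioms_def)

lemma restr_id: "restr H (igpd_id H) = xmod_id (xmod_of H)"
  by (auto simp: restr_def igpd_id_def xmod_id_def fun_eq_iff restrict_def kernel_def)

text \<open>
  Faithfulness: \<open>Ker d0\<close> and the image of \<open>\<epsilon>\<close> generate all elements.
\<close>

lemma restr_inj:
  assumes "internal_gpd_morphism T H K f" "internal_gpd_morphism T H K g" and eq: "restr H f = restr H g"
  shows "f = g"
proof -
  interpret f: internal_gpd_morphism T H K f by fact
  interpret g: internal_gpd_morphism T H K g by fact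
  have snd_eq: "snd f = snd g"
    using eq by (simp add: restr_def)
  have ker_eq: "fst f a = fst g a" if "a \<in> f.H.Ker" for a
  proof -
    have "fst (restr H f) a = fst (restr H g) a" by (simp add: eq)
    then show ?thesis using that by (simp add: restr_def)
  qed
  have "fst f e = fst g e" if "e \<in> carrier (elts H)" for e
    by (rule f.H.ext.hom_eqI[OF f.f1.gwo_morphism_axioms g.f1.gwo_morphism_axioms])
      (use that ker_eq in \<open>simp_all add: snd_eq\<close>)
  then have "fst f = fst g"
    using f.f g.f by (auto intro: extensionalityI simp: igpd_hom_iff)
  with snd_eq show ?thesis by (rule prod_eqI[rotated])
qed

text \<open>
  Fullness: the lift of \<open>(g1, g0)\<close> sends \<open>a + \<epsilon> b\<close> to \<open>g1 a + \<epsilon> (g0 b)\<close>. The compatibility with the actions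
  in the definition of a morphism of crossed modules is the hypothesis of the universal property.
\<close>

lemma restr_surj:
  assumes "internal_gpd T H" "internal_gpd T K" and g: "g \<in> xmod_hom T (xmod_of H) (xmod_of K)"
  obtains f where "f \<in> igpd_hom T H K" "restr H f = g"
proof -
  interpret H: internal_gpd T H by fact
  interpret K: internal_gpd T K by fact
  note hom = g[unfolded xmod_hom_iff xmod_of_simps]
  interpret g1: gwo_morphism T "gwo_kernel (elts H) (objs H) (d0 H)"
    "gwo_kernel (elts K) (objs K) (d0 K)" "fst g"
    using hom by (intro gwo_morphismI H.A.gwo_axioms K.A.gwo_axioms) simp
  interpret g0: gwo_morphism T "objs H" "objs K" "snd g"
    using hom by (intro gwo_morphismI H.B.gwo_axioms K.B.gwo_axioms) simp
  have u: "gwo_morphism T (gwo_kernel (elts H) (objs H) (d0 H)) (elts K) (fst g)"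
    using gwo_morphism_comp[OF g1.gwo_morphism_axioms K.incl.gwo_morphism_axioms] .
  have w: "gwo_morphism T (objs H) (elts K) (\<lambda>b. eps K (snd g b))"
    using gwo_morphism_comp[OF g0.gwo_morphism_axioms K.eps.gwo_morphism_axioms] .
  define h where "h = H.ext.glue (elts K) (fst g) (\<lambda>b. eps K (snd g b))"
  have h: "gwo_morphism T (elts H) (elts K) h"
    unfolding h_def
  proof (rule H.ext.glue_morphism[OF u w])
    fix b a assume *: "b \<in> carrier (objs H)" "a \<in> carrier (gwo_kernel (elts H) (objs H) (d0 H))"
    with hom have "fst g (dot (xmod_of H) b a) = dot (xmod_of K) (snd g b) (fst g a)" by simp
    then show "fst g (dot (xmod_of H) b a) =
        eps K (snd g b) \<otimes>\<^bsub>elts K\<^esub> fst g a \<otimes>\<^bsub>elts K\<^esub> inv\<^bsub>elts K\<^esub> (eps K (snd g b))"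
      by (simp add: xmod_of_def)
  next
    fix \<beta> b a assume *: "\<beta> \<in> Binary T" "b \<in> carrier (objs H)"
      "a \<in> carrier (gwo_kernel (elts H) (objs H) (d0 H))"
    with hom have "fst g (star (xmod_of H) \<beta> b a) = star (xmod_of K) \<beta> (snd g b) (fst g a)" by simp
    then show "fst g (star (xmod_of H) \<beta> b a) = binop (elts K) \<beta> (eps K (snd g b)) (fst g a)"
      by (simp add: xmod_of_def)
  qed
  interpret h: gwo_morphism T "elts H" "elts K" h by (rule h)
  have h_ker [simp]: "h a = fst g a" if "a \<in> H.Ker" for a
    unfolding h_def using H.ext.glue_i[OF u w] that by simp
  have h_eps [simp]: "h (eps H b) = eps K (snd g b)" if "b \<in> carrier (objs H)" for b
    unfolding h_def using H.ext.glue_s[OF u w] that by simp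
  have g1_ker: "fst g a \<in> K.Ker" if "a \<in> H.Ker" for a
    using g1.hom_closed[of a] that by simp
  have d0: "d0 K (h e) = snd g (d0 H e)" if "e \<in> carrier (elts H)" for e
    by (rule H.ext.hom_eqI[OF gwo_morphism_comp[OF h K.d0.gwo_morphism_axioms]
          gwo_morphism_comp[OF H.d0.gwo_morphism_axioms g0.gwo_morphism_axioms]])
      (use that in \<open>simp_all add: g1_ker K.KerD H.KerD\<close>)
  have d1: "d1 K (h e) = snd g (d1 H e)" if "e \<in> carrier (elts H)" for e
    by (rule H.ext.hom_eqI[OF gwo_morphism_comp[OF h K.d1.gwo_morphism_axioms]
          gwo_morphism_comp[OF H.d1.gwo_morphism_axioms g0.gwo_morphism_axioms]])
      (use that hom in simp_all)
  have "(restrict h (carrier (elts H)), snd g) \<in> igpd_hom T H K"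
    by (rule igpd_homI[OF H.internal_gpd_axioms K.internal_gpd_axioms gwo_hom_cong[OF h]])
      (use hom g0.hom in \<open>simp_all add: d0 d1\<close>)
  moreover have "restr H (restrict h (carrier (elts H)), snd g) = g"
  proof (rule prod_eqI)
    show "fst (restr H (restrict h (carrier (elts H)), snd g)) = fst g"
      by (rule extensionalityI[of _ H.Ker]) (use hom in \<open>simp_all add: restr_def H.KerD del: restrict_restrict\<close>)
  qed (simp add: restr_def)
  ultimately show thesis by (rule that)
qed


section \<open>The equivalence of the categories of covers\<close>

lemma ball_pairs: "(\<forall>x \<in> A. P x) \<longleftrightarrow> (\<forall>a b. (a, b) \<in> A \<longrightarrow> P (a, b))"
  by auto

lemma Cov_Cat_simps:
  "(H, p) \<in> Obj (Cov_Cat T G) \<longleftrightarrow> internal_groupoid T H \<and> p \<in> igpd_hom T H G \<and>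
     covering_morphism (underlying H) (underlying G) p"
  "f \<in> Hom (Cov_Cat T G) (H, p) (K, q) \<longleftrightarrow> f \<in> igpd_hom T H K \<and>
     covering_morphism (underlying H) (underlying K) f \<and> igpd_compose H q f = p"
  "Ident (Cov_Cat T G) (H, p) = igpd_id H"
  "Comp (Cov_Cat T G) (H, p) Y Z = igpd_compose H"
  by (simp_all add: Cov_Cat_def)

lemma Cov_XMod_simps:
  "(X, p) \<in> Obj (Cov_XMod T Y) \<longleftrightarrow> crossed_module T X \<and> xmod_cover T X Y p"
  "f \<in> Hom (Cov_XMod T Y) (X, p) (X', q) \<longleftrightarrow> f \<in> xmod_hom T X X' \<and> xmod_compose X q f = p"
  "Ident (Cov_XMod T Y) (X, p) = xmod_id X"
  "Comp (Cov_XMod T Y) (X, p) U W = xmod_compose X"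
  by (simp_all add: Cov_XMod_def)

context internal_gpd
begin

lemma cover_morphism:
  assumes "(H, p) \<in> Obj (Cov_Cat T G)"
  shows "internal_gpd_morphism T H G p"
  using assms ops_theory
  by (intro internal_gpd_morphismI internal_gpd_axioms) (simp_all add: Cov_Cat_simps internal_gpd_def)

lemma cover_internal: "(H, p) \<in> Obj (Cov_Cat T G) \<Longrightarrow> internal_gpd T H"
  using ops_theory by (simp add: Cov_Cat_simps internal_gpd_def)

lemma cover_bij:
  assumes "(H, p) \<in> Obj (Cov_Cat T G)"
  shows "bij_betw (fst p) (kernel (elts H) (objs H) (d0 H)) Ker"
  using internal_gpd_morphism.covering_iff[OF cover_morphism[OF assms]] assms
  by (simp add: Cov_Cat_simps)

text \<open>
  On kernels \<open>q \<circ> f = p\<close> with \<open>p\<close> and \<open>q\<close> bijective, so \<open>f\<close> is bijective there. This is why the lift of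
  any morphism between covers of crossed modules is itself a covering.
\<close>

lemma between_covers_covering:
  assumes H: "(H, p) \<in> Obj (Cov_Cat T G)" and K: "(K, q) \<in> Obj (Cov_Cat T G)"
    and f: "f \<in> igpd_hom T H K" and qf: "igpd_compose H q f = p"
  shows "covering_morphism (underlying H) (underlying K) f"
proof -
  interpret f: internal_gpd_morphism T H K f
    using H K f by (intro internal_gpd_morphismI cover_internal)
  have "bij_betw (fst q \<circ> fst f) f.H.Ker Ker"
    using cover_bij[OF H] unfolding qf[symmetric] igpd_compose_def
    by (rule bij_betw_cong[THEN iffD1, rotated]) (simp add: compose_eq f.H.KerD)
  moreover have "fst f ` f.H.Ker \<subseteq> f.K.Ker"
    using f.hom_Ker by blast
  ultimately have "bij_betw (fst f) f.H.Ker f.K.Ker"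
    using bij_betw_comp_iff2[OF cover_bij[OF K]] by blast
  then show ?thesis by (simp add: f.covering_iff)
qed

lemma Cov_Cat_Hom_iff:
  assumes "(H, p) \<in> Obj (Cov_Cat T G)" "(K, q) \<in> Obj (Cov_Cat T G)"
  shows "f \<in> Hom (Cov_Cat T G) (H, p) (K, q) \<longleftrightarrow> f \<in> igpd_hom T H K \<and> igpd_compose H q f = p"
  using between_covers_covering[OF assms, of f] by (auto simp: Cov_Cat_simps)

lemma Cov_Cat_category: "is_category (Cov_Cat T G)"
proof -
  have "igpd_id H \<in> Hom (Cov_Cat T G) (H, p) (H, p)" if "(H, p) \<in> Obj (Cov_Cat T G)" for H p
    using that cover_internal[OF that] igpd_compose_id(1)[of p T H G]
    by (simp add: Cov_Cat_Hom_iff igpd_id_hom) (simp add: Cov_Cat_simps)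
  moreover have "igpd_compose H g f \<in> Hom (Cov_Cat T G) (H, p) (L, r)"
    if "(H, p) \<in> Obj (Cov_Cat T G)" "(K, q) \<in> Obj (Cov_Cat T G)" "(L, r) \<in> Obj (Cov_Cat T G)"
      "f \<in> Hom (Cov_Cat T G) (H, p) (K, q)" "g \<in> Hom (Cov_Cat T G) (K, q) (L, r)" for H p K q L r f g
    using that cover_internal[OF that(1)] cover_internal[OF that(2)] cover_internal[OF that(3)]
      igpd_compose_hom[of T H K f L g] igpd_compose_assoc[of f T H K r g]
    by (simp add: Cov_Cat_Hom_iff internal_gpd_morphismI)
  moreover have "igpd_compose H f (igpd_id H) = f \<and> igpd_compose H (igpd_id K) f = f"
    if "f \<in> Hom (Cov_Cat T G) (H, p) (K, q)" for H p K q f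
    using that igpd_compose_id[of f T H K] by (simp add: Cov_Cat_simps)
  moreover have "igpd_compose H (igpd_compose K h g) f = igpd_compose H h (igpd_compose H g f)"
    if "f \<in> Hom (Cov_Cat T G) (H, p) (K, q)" for H p K q f g h
    using that igpd_compose_assoc[of f T H K h g] by (simp add: Cov_Cat_simps)
  ultimately show ?thesis
    unfolding is_category_def ball_pairs[of "Obj (Cov_Cat T G)"] Cov_Cat_simps(3,4)
    by (intro conjI allI impI ballI) blast+
qed

end

lemma Cov_XMod_category:
  assumes T: "groups_with_operations_theory T" and Y: "crossed_module T Y"
  shows "is_category (Cov_XMod T Y)"
proof -
  have X: "xmodule T X" if "(X, p) \<in> Obj (Cov_XMod T Y)" for X p
    using that T by (simp add: Cov_XMod_simps xmodule_def)
  have "xmod_id X \<in> Hom (Cov_XMod T Y) (X, p) (X, p)" if "(X, p) \<in> Obj (Cov_XMod T Y)" for X p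
    using that X[OF that] xmod_id_hom[of T X] xmod_compose_id(1)[of p T X Y]
    by (simp add: Cov_XMod_simps xmod_cover_def)
  moreover have "xmod_compose X g f \<in> Hom (Cov_XMod T Y) (X, p) (Z, r)"
    if "(X, p) \<in> Obj (Cov_XMod T Y)" "(X', q) \<in> Obj (Cov_XMod T Y)" "(Z, r) \<in> Obj (Cov_XMod T Y)"
      "f \<in> Hom (Cov_XMod T Y) (X, p) (X', q)" "g \<in> Hom (Cov_XMod T Y) (X', q) (Z, r)"
    for X p X' q Z r f g
    using that xmod_compose_hom[OF X[OF that(1)] X[OF that(2)] X[OF that(3)], of f g]
      xmod_compose_assoc[of f T X X' r g]
    by (simp add: Cov_XMod_simps)
  moreover have "xmod_compose X f (xmod_id X) = f \<and> xmod_compose X (xmod_id X') f = f"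
    if "f \<in> Hom (Cov_XMod T Y) (X, p) (X', q)" for X p X' q f
    using that xmod_compose_id[of f T X X'] by (simp add: Cov_XMod_simps)
  moreover have "xmod_compose X (xmod_compose X' h g) f = xmod_compose X h (xmod_compose X g f)"
    if "f \<in> Hom (Cov_XMod T Y) (X, p) (X', q)" for X p X' q f g h
    using that xmod_compose_assoc[of f T X X' h g] by (simp add: Cov_XMod_simps)
  ultimately show ?thesis
    unfolding is_category_def ball_pairs[of "Obj (Cov_XMod T Y)"] Cov_XMod_simps(3,4)
    by (intro conjI allI impI ballI) blast+
qed

text \<open>
  Every crossed module is isomorphic to that of an internal groupoid, namely the one built on the
  split extension that witnesses its derived action. The isomorphism is the embedding \<open>i\<close> of \<open>A\<close> onto
  the kernel of \<open>p\<close>, together with the identity of \<open>B\<close>.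
\<close>

lemma xmod_of_crossed_extension:
  fixes X :: "('u, 'w, 's) xmod"
  assumes X: "xmodule T X"
  obtains H :: "('u, 'w, 's) igpd" and \<phi> \<psi> where "internal_gpd T H"
    "\<phi> \<in> xmod_hom T X (xmod_of H)" "\<psi> \<in> xmod_hom T (xmod_of H) X"
    "xmod_compose X \<psi> \<phi> = xmod_id X" "xmod_compose (xmod_of H) \<phi> \<psi> = xmod_id (xmod_of H)"
    "bij_betw (fst \<psi>) (carrier (xtop (xmod_of H))) (carrier (xtop X))"
proof -
  interpret X: xmodule T X by fact
  obtain E :: "('u, 'w, 's) gwo" and i p s where
    ext: "crossed_extension T (xtop X) (xbase X) E i p s (dot X) (star X) (bd X)"
    using crossed_module_extension[OF X.ops_theory X.crossed] by blast
  interpret crossed_extension T "xtop X" "xbase X" E i p s "dot X" "star X" "bd X" by (rule ext)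
  define H where "H = \<lparr>elts = E, objs = xbase X, d0 = p, d1 = target, eps = s,
     gcomp = \<lambda>e e'. e' \<otimes>\<^bsub>E\<^esub> inv\<^bsub>E\<^esub> (s (p e')) \<otimes>\<^bsub>E\<^esub> e\<rparr>"
  have H_simps: "elts H = E" "objs H = xbase X" "d0 H = p" "d1 H = target" "eps H = s"
    by (simp_all add: H_def)
  have H: "internal_gpd T H"
    unfolding internal_gpd_def H_def
    using internal_groupoid_of_crossed_extension[OF ext] X.ops_theory by simp
  then have xH: "xmodule T (xmod_of H)" by (rule internal_gpd_xmodule)
  define \<phi> where "\<phi> = (restrict i (carrier (xtop X)), \<lambda>b \<in> carrier (xbase X). b)"
  have top: "carrier (xtop (xmod_of H)) = i ` carrier (xtop X)"
    by (simp add: H_simps i_image)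
  have "restrict i (carrier (xtop X)) \<in> gwo_hom T (xtop X) (xtop (xmod_of H))"
    by (rule gwo_homI) (simp_all add: H_simps kernel_def)
  moreover have "(\<lambda>b \<in> carrier (xbase X). b) \<in> gwo_hom T (xbase X) (xbase X)"
    by (auto intro: gwo_hom_cong[OF gwo_morphism_id] B.gwo_axioms)
  ultimately have \<phi>: "\<phi> \<in> xmod_hom T X (xmod_of H)"
    by (simp add: xmod_hom_iff \<phi>_def) (simp add: xmod_of_def H_simps)
  have "bij_betw (fst \<phi>) (carrier (xtop X)) (carrier (xtop (xmod_of H)))"
    unfolding top using i_inj by (simp add: \<phi>_def bij_betw_def)
  moreover have "bij_betw (snd \<phi>) (carrier (xbase X)) (carrier (xbase (xmod_of H)))"
    by (simp add: \<phi>_def H_simps bij_betw_def)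
  ultimately obtain \<psi> where "\<psi> \<in> xmod_hom T (xmod_of H) X"
    "xmod_compose X \<psi> \<phi> = xmod_id X" "xmod_compose (xmod_of H) \<phi> \<psi> = xmod_id (xmod_of H)"
    "bij_betw (fst \<psi>) (carrier (xtop (xmod_of H))) (carrier (xtop X))"
    by (rule xmod_inverse[OF X xH \<phi>])
  with H \<phi> show thesis by (rule that)
qed

context internal_gpd
begin

lemma restr_cover:
  assumes "(H, p) \<in> Obj (Cov_Cat T G)"
  shows "(xmod_of H, restr H p) \<in> Obj (Cov_XMod T (xmod_of G))"
proof -
  interpret p: internal_gpd_morphism T H G p using assms by (rule cover_morphism)
  have "fst (restr H p) \<in> gwo_iso T (xtop (xmod_of H)) (xtop (xmod_of G))"
  proof (rule gwo_isoI(1))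
    show "bij_betw (fst (restr H p)) (carrier (xtop (xmod_of H))) (carrier (xtop (xmod_of G)))"
      using cover_bij[OF assms] by (simp add: restr_def)
  qed (use p.restr_hom in \<open>simp_all add: p.H.A.gwo_axioms A.gwo_axioms xmod_hom_iff\<close>)
  then show ?thesis
    using p.restr_hom p.H.crossed_module by (simp add: Cov_XMod_simps xmod_cover_def)
qed

lemma restr_bij_Hom:
  assumes H: "(H, p) \<in> Obj (Cov_Cat T G)" and K: "(K, q) \<in> Obj (Cov_Cat T G)"
  shows "bij_betw (restr H) (Hom (Cov_Cat T G) (H, p) (K, q))
    (Hom (Cov_XMod T (xmod_of G)) (xmod_of H, restr H p) (xmod_of K, restr K q))"
proof (rule bij_betw_imageI)
  note gpds = cover_internal[OF H] cover_internal[OF K]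
  have mor: "internal_gpd_morphism T H K f" if "f \<in> Hom (Cov_Cat T G) (H, p) (K, q)" for f
    using that gpds by (intro internal_gpd_morphismI) (simp_all add: Cov_Cat_simps)
  show "inj_on (restr H) (Hom (Cov_Cat T G) (H, p) (K, q))"
    using restr_inj mor by (blast intro: inj_onI)
  show "restr H ` Hom (Cov_Cat T G) (H, p) (K, q) =
    Hom (Cov_XMod T (xmod_of G)) (xmod_of H, restr H p) (xmod_of K, restr K q)"
  proof
    show "restr H ` Hom (Cov_Cat T G) (H, p) (K, q) \<subseteq>
      Hom (Cov_XMod T (xmod_of G)) (xmod_of H, restr H p) (xmod_of K, restr K q)"
    proof
      fix g assume "g \<in> restr H ` Hom (Cov_Cat T G) (H, p) (K, q)"
      then obtain f where f: "f \<in> Hom (Cov_Cat T G) (H, p) (K, q)" "g = restr H f" by blast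
      interpret f: internal_gpd_morphism T H K f using f(1) by (rule mor)
      show "g \<in> Hom (Cov_XMod T (xmod_of G)) (xmod_of H, restr H p) (xmod_of K, restr K q)"
        using f f.restr_hom f.restr_compose[of q] by (simp add: Cov_Cat_simps Cov_XMod_simps)
    qed
    show "Hom (Cov_XMod T (xmod_of G)) (xmod_of H, restr H p) (xmod_of K, restr K q) \<subseteq>
      restr H ` Hom (Cov_Cat T G) (H, p) (K, q)"
    proof
      fix g assume "g \<in> Hom (Cov_XMod T (xmod_of G)) (xmod_of H, restr H p) (xmod_of K, restr K q)"
      then have g: "g \<in> xmod_hom T (xmod_of H) (xmod_of K)"
        "xmod_compose (xmod_of H) (restr K q) g = restr H p"
        by (simp_all add: Cov_XMod_simps)
      obtain f where f: "f \<in> igpd_hom T H K" "restr H f = g"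
        using restr_surj[OF gpds g(1)] .
      interpret f: internal_gpd_morphism T H K f
        using gpds f(1) by (rule internal_gpd_morphismI)
      have "internal_gpd_morphism T H G (igpd_compose H q f)"
        using igpd_compose_hom[OF f.internal_gpd_morphism_axioms cover_morphism[OF K]]
        by (rule internal_gpd_morphismI[OF gpds(1) internal_gpd_axioms])
      then have "igpd_compose H q f = p"
        using cover_morphism[OF H] by (rule restr_inj) (simp add: f.restr_compose f(2) g(2))
      then have "f \<in> Hom (Cov_Cat T G) (H, p) (K, q)"
        using f(1) by (simp add: Cov_Cat_Hom_iff[OF H K])
      then show "g \<in> restr H ` Hom (Cov_Cat T G) (H, p) (K, q)"
        unfolding f(2)[symmetric] by (rule imageI)
    qed
  qed
qed

text \<open>
  The isomorphism \<open>\<psi>\<close> from the crossed module of \<open>H\<close> to \<open>X\<close> followed by the cover \<open>p\<close> lifts, by fullness, to a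
  morphism \<open>P\<close> from \<open>H\<close> to \<open>G\<close>. It is a covering since \<open>p\<close> and \<open>\<psi>\<close> are bijective on the top objects.
\<close>

lemma restr_essentially_surjective:
  assumes "(X, p) \<in> Obj (Cov_XMod T (xmod_of G))"
  shows "\<exists>H P u. (H, P) \<in> Obj (Cov_Cat T G) \<and>
    is_isomorphism (Cov_XMod T (xmod_of G)) (xmod_of H, restr H P) (X, p) u"
proof -
  have X: "xmodule T X" and p: "p \<in> xmod_hom T X (xmod_of G)"
    and iso: "fst p \<in> gwo_iso T (xtop X) (xtop (xmod_of G))"
    using assms ops_theory by (simp_all add: Cov_XMod_simps xmod_cover_def xmodule_def)
  obtain H \<phi> \<psi> where H: "internal_gpd T H"
    and \<phi>: "\<phi> \<in> xmod_hom T X (xmod_of H)" and \<psi>: "\<psi> \<in> xmod_hom T (xmod_of H) X"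
    and inv: "xmod_compose X \<psi> \<phi> = xmod_id X" "xmod_compose (xmod_of H) \<phi> \<psi> = xmod_id (xmod_of H)"
    and bij: "bij_betw (fst \<psi>) (carrier (xtop (xmod_of H))) (carrier (xtop X))"
    using xmod_of_crossed_extension[OF X] .
  interpret H: internal_gpd T H by (rule H)
  have "xmod_compose (xmod_of H) p \<psi> \<in> xmod_hom T (xmod_of H) (xmod_of G)"
    using internal_gpd_xmodule[OF H] X internal_gpd_xmodule[OF internal_gpd_axioms] \<psi> p
    by (rule xmod_compose_hom)
  then obtain P where P: "P \<in> igpd_hom T H G" "restr H P = xmod_compose (xmod_of H) p \<psi>"
    by (rule restr_surj[OF H internal_gpd_axioms])
  interpret P: internal_gpd_morphism T H G P
    using H internal_gpd_axioms P(1) by (rule internal_gpd_morphismI)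
  have "bij_betw (fst p \<circ> fst \<psi>) H.Ker Ker"
    using bij_betw_trans[OF bij gwo_iso_bij[OF iso]] by simp
  then have "bij_betw (fst P) H.Ker Ker"
  proof (rule bij_betw_cong[THEN iffD1, rotated])
    fix a assume a: "a \<in> H.Ker"
    have "fst (restr H P) a = fst (xmod_compose (xmod_of H) p \<psi>) a" by (simp add: P(2))
    then show "(fst p \<circ> fst \<psi>) a = fst P a"
      using a by (simp add: restr_def xmod_compose_def compose_eq)
  qed
  then have obj: "(H, P) \<in> Obj (Cov_Cat T G)"
    using P(1) H.internal by (simp add: Cov_Cat_simps P.covering_iff)
  have "xmod_compose X (restr H P) \<phi> = p"
    using xmod_compose_assoc[OF \<phi>, of p \<psi>] xmod_compose_id[OF p] inv(1) by (simp add: P(2))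
  then have "is_isomorphism (Cov_XMod T (xmod_of G)) (xmod_of H, restr H P) (X, p) \<psi>"
    unfolding is_isomorphism_def
    using \<phi> \<psi> inv by (intro conjI bexI[of _ \<phi>]) (simp_all add: Cov_XMod_simps P(2))
  with obj show ?thesis by blast
qed

end

theorem theorem5p2:
  fixes T :: "('w, 's) op_theory"
    and G :: "('u, 'w, 's) igpd"
  assumes "groups_with_operations_theory T"
    and "internal_groupoid T G"
  shows "equivalent_categories (Cov_Cat T G) (Cov_XMod T (xmod_of G))"
proof -
  interpret internal_gpd T G using assms by (rule internal_gpd.intro)
  let ?Fo = "\<lambda>(H, p). (xmod_of H, restr H p)"
    and ?Fm = "\<lambda>(H, p) _ f. restr H f"
  show ?thesis
  proof (rule equivalent_categories_if_fully_faithful)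
    show "is_category (Cov_Cat T G)" by (rule Cov_Cat_category)
    show "is_category (Cov_XMod T (xmod_of G))"
      using ops_theory crossed_module by (rule Cov_XMod_category)
    show "is_functor (Cov_Cat T G) (Cov_XMod T (xmod_of G)) ?Fo ?Fm"
      unfolding is_functor_def ball_pairs[of "Obj (Cov_Cat T G)"] prod.case
        Cov_Cat_simps(3,4) Cov_XMod_simps(3,4)
    proof (intro conjI allI impI ballI)
      fix H p K q L r f g
      assume "(H, p) \<in> Obj (Cov_Cat T G)" "(K, q) \<in> Obj (Cov_Cat T G)"
        "f \<in> Hom (Cov_Cat T G) (H, p) (K, q)"
      then interpret f: internal_gpd_morphism T H K f
        using ops_theory by (intro internal_gpd_morphismI) (simp_all add: Cov_Cat_simps internal_gpd_def)
      show "restr H (igpd_compose H g f) = xmod_compose (xmod_of H) (restr K g) (restr H f)"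
        by (rule f.restr_compose)
    qed (auto simp: restr_cover restr_id intro: bij_betw_apply[OF restr_bij_Hom])
  next
    fix X Y assume "X \<in> Obj (Cov_Cat T G)" "Y \<in> Obj (Cov_Cat T G)"
    then show "bij_betw (?Fm X Y) (Hom (Cov_Cat T G) X Y)
        (Hom (Cov_XMod T (xmod_of G)) (?Fo X) (?Fo Y))"
      by (cases X; cases Y) (simp add: restr_bij_Hom)
  next
    fix Y assume "Y \<in> Obj (Cov_XMod T (xmod_of G))"
    then obtain H P u where "(H, P) \<in> Obj (Cov_Cat T G)"
      "is_isomorphism (Cov_XMod T (xmod_of G)) (xmod_of H, restr H P) Y u"
      using restr_essentially_surjective[of "fst Y" "snd Y"] by auto
    then show "\<exists>X \<in> Obj (Cov_Cat T G). \<exists>u. is_isomorphism (Cov_XMod T (xmod_of G)) (?Fo X) Y u"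
      by (intro bexI[of _ "(H, P)"] exI[of _ u]) simp_all
  qed
qed

end
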